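(* Let $f$ be a solution of $f''=qf$ on $[-b,b]$ with $f\neq0$ on $[-b,b]$, $f(0)=1$, $h:=f'(0)$, where $q\in C^p[-b,b]$ is complex valued, $p\ge0$ an integer. Let $u\in C^m[-b,b]$. Then there exist all the functions $(\gamma_2\gamma_1)^j[G_1u]$ for $j\le\min\{m,p+4\}$ and all the functions $(\gamma_2\gamma_1)^j[G_2u-u(0)]$ for $j\le\min\{m,p+3\}$, and they are given by the following expressions (for $n\ge1$ in the respective ranges $n\le\min\{m,p+4\}$ for $G_1$ and $n\le\min\{m,p+3\}$ for $G_2$). If $n=2k$, then $$(2\gamma_2\gamma_1)^nG_1u=G_1u^{(n)}+f\cdot u^{(n)}(0)-2\sum_{\text{even }j=2}^{n}u^{(j)}(0)\cdot(2\gamma_2\gamma_1)^{n-j}[1],$$ $$(2\gamma_2\gamma_1)^n[G_2u-u(0)]=G_2u^{(n)}-u^{(n)}(0)-2\sum_{\text{odd }j=1}^{n-1}u^{(j)}(0)\cdot(2\gamma_2\gamma_1)^{n-j}[1].$$ If $n=2k+1$, then $$(2\gamma_2\gamma_1)^nG_1u=G_2u^{(n)}-u^{(n)}(0)-2\sum_{\text{even }j=2}^{n-1}u^{(j)}(0)\,(2\gamma_2\gamma_1)^{n-j}[1],$$ $$(2\gamma_2\gamma_1)^n[G_2u-u(0)]=G_1u^{(n)}+f\cdot u^{(n)}(0)-2\sum_{\text{odd }j=1}^{n}u^{(j)}(0)\,(2\gamma_2\gamma_1)^{n-j}[1].$$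
   Context: Kernel: $\mathbf{K}(x,t)=\mathbf{H}\big(\frac{x+t}{2},\frac{x-t}{2}\big)$ on $[-b,b]^2$, where $\mathbf{H}$ is the unique solution of $\frac{\partial^2\mathbf{H}(u,v)}{\partial u\,\partial v}=q(u+v)\mathbf{H}(u,v)$, $\mathbf{H}(u,0)=\frac h2+\frac12\int_0^u q(s)\,ds$, $\mathbf{H}(0,v)=\frac h2$ (equivalently $\mathbf{H}(u,v)=\frac h2+\frac12\int_0^u q(s)\,ds+\int_0^u\int_0^v q(\alpha+\beta)\mathbf{H}(\alpha,\beta)\,d\beta\,d\alpha$). Operators: $G_\pm\eta(x)=\eta(x)+\int_{-x}^x\mathbf{K}(x,t)\left(\eta\left(\frac{t+x}2\right)\pm\eta\left(\frac{t-x}2\right)\right)dt$, $G_1\eta=G_+\left[\eta-\frac{\eta(0)}2\right]+\frac{\eta(0)}2$, $G_2\eta=G_-\eta$ (these formulas make sense for $\eta\in C[-b,b]$). Generalized derivative: on $C^1[-b,b]$, $\gamma_2\gamma_1g(x)=\frac12\left(g'(x)-g'(0)-\int_0^xq(s)g(s)\,ds\right)$. $(\gamma_2\gamma_1)^0$ is the identity; $(\gamma_2\gamma_1)^jg$ exists if $(\gamma_2\gamma_1)^{j-1}g$ exists and is in $C^1[-b,b]$, and is then $\gamma_2\gamma_1$ applied to it. $(2\gamma_2\gamma_1)^j=2^j(\gamma_2\gamma_1)^j$; $(2\gamma_2\gamma_1)^j[1]$ is its action on the constant function $1$. Empty sums are $0$. *)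

theory Defs
  imports "HOL-Analysis.Analysis"
begin

text \<open>Everything lives on the compact interval \<open>{- b..b}\<close>; derivatives are taken within the
  interval, hence one-sided at the endpoints. Integrals \<open>LBINT t=a..c. _\<close> are oriented,
  so they make sense for \<open>c < a\<close>.\<close>

definition nderiv :: "real set \<Rightarrow> nat \<Rightarrow> (real \<Rightarrow> complex) \<Rightarrow> real \<Rightarrow> complex" where
  "nderiv S n g = ((\<lambda>g x. vector_derivative g (at x within S)) ^^ n) g"

definition C_on :: "nat \<Rightarrow> real set \<Rightarrow> (real \<Rightarrow> complex) \<Rightarrow> bool" where
  "C_on k S g \<longleftrightarrow>
     (\<forall>j<k. \<forall>x\<in>S. nderiv S j g differentiable (at x within S)) \<and>
     continuous_on S (nderiv S k g)"

text \<open>The Goursat problem is posed on the diamond \<open>\<bar>u\<bar> + \<bar>v\<bar> \<le> b\<close>, the image of the square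
  \<open>[-b,b] \<times> [-b,b]\<close> under \<open>(x, t) \<mapsto> ((x + t) / 2, (x - t) / 2)\<close>. Its solution is unique there,
  so only the values on the diamond matter. The function \<open>Hv\<close> is the partial derivative
  of \<open>H\<close> in \<open>v\<close>.\<close>

definition goursat_solution ::
    "real \<Rightarrow> (real \<Rightarrow> complex) \<Rightarrow> complex \<Rightarrow> (real \<Rightarrow> real \<Rightarrow> complex) \<Rightarrow> bool" where
  "goursat_solution b q h H \<longleftrightarrow>
     continuous_on {(u, v). \<bar>u\<bar> + \<bar>v\<bar> \<le> b} (\<lambda>(u, v). H u v) \<and>
     (\<exists>Hv. \<forall>u v. \<bar>u\<bar> + \<bar>v\<bar> \<le> b \<longrightarrow>
        ((\<lambda>v'. H u v') has_vector_derivative Hv u v) (at v within {v'. \<bar>u\<bar> + \<bar>v'\<bar> \<le> b}) \<and>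
        ((\<lambda>u'. Hv u' v) has_vector_derivative q (u + v) * H u v)
          (at u within {u'. \<bar>u'\<bar> + \<bar>v\<bar> \<le> b})) \<and>
     (\<forall>u\<in>{- b..b}. H u 0 = h / 2 + (LBINT s=0..u. q s) / 2) \<and>
     (\<forall>v\<in>{- b..b}. H 0 v = h / 2)"

definition kernel_of :: "(real \<Rightarrow> real \<Rightarrow> complex) \<Rightarrow> real \<Rightarrow> real \<Rightarrow> complex" where
  "kernel_of H x t = H ((x + t) / 2) ((x - t) / 2)"

definition G_plus ::
    "(real \<Rightarrow> real \<Rightarrow> complex) \<Rightarrow> (real \<Rightarrow> complex) \<Rightarrow> real \<Rightarrow> complex" where
  "G_plus K \<eta> x = \<eta> x + (LBINT t=- x..x. K x t * (\<eta> ((t + x) / 2) + \<eta> ((t - x) / 2)))"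

definition G_minus ::
    "(real \<Rightarrow> real \<Rightarrow> complex) \<Rightarrow> (real \<Rightarrow> complex) \<Rightarrow> real \<Rightarrow> complex" where
  "G_minus K \<eta> x = \<eta> x + (LBINT t=- x..x. K x t * (\<eta> ((t + x) / 2) - \<eta> ((t - x) / 2)))"

definition G1 ::
    "(real \<Rightarrow> real \<Rightarrow> complex) \<Rightarrow> (real \<Rightarrow> complex) \<Rightarrow> real \<Rightarrow> complex" where
  "G1 K \<eta> x = G_plus K (\<lambda>y. \<eta> y - \<eta> 0 / 2) x + \<eta> 0 / 2"

definition G2 ::
    "(real \<Rightarrow> real \<Rightarrow> complex) \<Rightarrow> (real \<Rightarrow> complex) \<Rightarrow> real \<Rightarrow> complex" where
  "G2 K \<eta> = G_minus K \<eta>"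

definition gamma21 ::
    "real \<Rightarrow> (real \<Rightarrow> complex) \<Rightarrow> (real \<Rightarrow> complex) \<Rightarrow> real \<Rightarrow> complex" where
  "gamma21 b q g x =
     (nderiv {- b..b} 1 g x - nderiv {- b..b} 1 g 0 - (LBINT s=0..x. q s * g s)) / 2"

text \<open>The operator is only defined on \<open>C\<^sup>1\<close> functions; \<open>gamma21_exists b q j g\<close> says that the
  \<open>j\<close>-th iterate on \<open>g\<close> is defined, in which case it is \<open>(gamma21 b q ^^ j) g\<close>.\<close>

primrec gamma21_exists ::
    "real \<Rightarrow> (real \<Rightarrow> complex) \<Rightarrow> nat \<Rightarrow> (real \<Rightarrow> complex) \<Rightarrow> bool" where
  "gamma21_exists b q 0 g \<longleftrightarrow> True"
| "gamma21_exists b q (Suc j) g \<longleftrightarrow>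
     gamma21_exists b q j g \<and> C_on 1 {- b..b} ((gamma21 b q ^^ j) g)"

definition two_gamma21_pow ::
    "real \<Rightarrow> (real \<Rightarrow> complex) \<Rightarrow> nat \<Rightarrow> (real \<Rightarrow> complex) \<Rightarrow> real \<Rightarrow> complex" where
  "two_gamma21_pow b q j g x = 2 ^ j * (gamma21 b q ^^ j) g x"

end

theory Submission
  imports Defs
begin

text \<open>
  Write \<open>T = 2 \<gamma>\<^sub>2 \<gamma>\<^sub>1\<close>, so \<open>T g (x) = g' (x) - g' (0) - \<integral>\<^sub>0\<^sup>x q g\<close>. Everything
  rests on two one-step identities for a \<open>C\<^sup>1\<close> function \<open>\<eta>\<close> (lemmas \<open>G1_step\<close>, \<open>G2_step\<close>):
  \<open>T (G\<^sub>1 \<eta>) = G\<^sub>2 \<eta>' - \<eta>' (0)\<close> and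
  \<open>T (G\<^sub>2 \<eta> - \<eta> (0)) = G\<^sub>1 \<eta>' + \<eta>' (0) f - 2 \<eta>' (0)\<close>.
  Since \<open>T\<close> is linear and \<open>T f = 0\<close>, each application of \<open>T\<close> moves from the \<open>G\<^sub>1\<close> chain of \<open>u\<close> to the
  \<open>G\<^sub>2\<close> chain of \<open>u'\<close> or conversely, and every second step leaves behind a multiple of an
  iterate \<open>T\<^sup>i [1]\<close>; the two formulas follow by one joint induction over all \<open>u\<close>
  (\<open>powers_of_G\<close>). The bounds \<open>p + 4\<close> and \<open>p + 3\<close> come from these residues alone: for
  \<open>q \<in> C\<^sup>p\<close> each step costs one derivative of \<open>T\<^sup>i [1] \<in> C\<^bsup>p + 2 - i\<^esup>\<close>
  (\<open>gamma21_exists_one\<close>), and in the \<open>G\<^sub>1\<close> chain the first residue appears after two steps, in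
  the \<open>G\<^sub>2\<close> chain after one.

  For the one-step identities, substitute \<open>t = 2 s - x\<close> in the defining integrals. This
  turns them into
  \<open>G\<^sub>\<plusminus> \<eta> (x) = \<eta> (x) + 2 \<integral>\<^sub>0\<^sup>x H (s, x - s) (\<eta> (s) \<plusminus> \<eta> (s - x)) ds\<close>,
  integrals over the diagonals \<open>u + v = x\<close> of the characteristic plane. Such an integral of
  \<open>N (u, v)\<close> has derivative \<open>N (0, x) + \<integral> N\<^sub>u\<close> as well as \<open>N (x, 0) + \<integral> N\<^sub>v\<close>
  (\<open>diagint_has_vector_derivative_fst\<close> and \<open>_snd\<close>). The first form is used for
  \<open>H (u, v) \<eta> (u)\<close> and the second for \<open>H (u, v) \<eta> (- v)\<close>: then \<open>\<eta>'\<close> appears exactly as in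
  \<open>G\<^sub>\<minusplus> \<eta>'\<close>, while by the Goursat problem \<open>H\<^sub>v\<close> and, up to the
  boundary value \<open>q (u) / 2\<close>, also \<open>H\<^sub>u\<close> are integrals of \<open>q H\<close> in one variable,
  which Fubini on a triangle (\<open>segint_diagint\<close>) recombines into
  \<open>\<integral>\<^sub>0\<^sup>x q G\<^sub>\<plusminus> \<eta>\<close>. The function \<open>f\<close> enters through
  \<open>G\<^sub>+ [1] = 2 f - 1\<close> (\<open>G_plus_one\<close>): the derivative formula for \<open>\<eta> = 1\<close>
  says that \<open>(G\<^sub>+ [1] + 1) / 2\<close> solves the Cauchy problem that determines \<open>f\<close>.
\<close>

section \<open>Integrals along segments and diagonals\<close>

text \<open>The oriented integral \<open>\<integral>\<^sub>0\<^sup>x g\<close>, rescaled to the unit interval: one formula then serves both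
  signs of \<open>x\<close>, and continuity in parameters reduces to integrals over a fixed interval.\<close>

definition segint :: "(real \<Rightarrow> complex) \<Rightarrow> real \<Rightarrow> complex" where
  "segint g x = of_real x * integral {0..1} (\<lambda>r. g (r * x))"

text \<open>The oriented integral \<open>\<integral>\<^sub>0\<^sup>x F (s, x - s) ds\<close> along the diagonal \<open>u + v = x\<close>, rescaled in the
  same way.\<close>

definition diagint :: "(real \<Rightarrow> real \<Rightarrow> complex) \<Rightarrow> real \<Rightarrow> complex" where
  "diagint F x = of_real x * integral {0..1} (\<lambda>r. F (r * x) ((1 - r) * x))"

definition diamond :: "real \<Rightarrow> (real \<times> real) set" where
  "diamond b = {(u, v). \<bar>u\<bar> + \<bar>v\<bar> \<le> b}"

lemma scaled_in_interval: "r * x \<in> {- c..c}" if "x \<in> {- c..c}" "r \<in> {0..1}" for r x c :: real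
proof -
  have "\<bar>r * x\<bar> \<le> 1 * \<bar>x\<bar>"
    unfolding abs_mult using that by (intro mult_right_mono) auto
  then show ?thesis using that by auto
qed

lemma diagonal_in_diamond: "(r * x, (1 - r) * x) \<in> diamond c"
  if "x \<in> {- c..c}" "r \<in> {0..1}" for r x c :: real
proof -
  have "\<bar>r * x\<bar> + \<bar>(1 - r) * x\<bar> = (r + (1 - r)) * \<bar>x\<bar>"
    using that by (simp only: abs_mult distrib_right) auto
  then show ?thesis using that by (auto simp: diamond_def)
qed

lemma scaled_in_diamond:
  assumes "(u, v) \<in> diamond b" "r \<in> {0..1}" "s \<in> {0..1}"
  shows "(r * u, s * v) \<in> diamond b"
proof -
  have "\<bar>r * u\<bar> \<le> 1 * \<bar>u\<bar>" "\<bar>s * v\<bar> \<le> 1 * \<bar>v\<bar>"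
    unfolding abs_mult using assms by (intro mult_right_mono; simp)+
  then show ?thesis using assms by (auto simp: diamond_def)
qed

lemma axes_in_diamond: "x \<in> {- b..b} \<Longrightarrow> (x, 0) \<in> diamond b" "x \<in> {- b..b} \<Longrightarrow> (0, x) \<in> diamond b"
  by (auto simp: diamond_def)

lemma LBINT_affine:
  fixes g :: "real \<Rightarrow> complex" and a k :: real
  assumes "continuous_on ((\<lambda>r. a + r * k) ` {0..1}) g"
  shows "(LBINT s=a..a + k. g s) = of_real k * integral {0..1} (\<lambda>r. g (a + r * k))"
proof -
  have cont: "continuous_on {0..1} (\<lambda>r. g (a + r * k))"
    by (intro continuous_on_compose2[OF assms] continuous_intros) auto
  have "(LBINT s=a..a + k. g s) = (LBINT r=(0::real)..(1::real). k *\<^sub>R g (a + r * k))"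
    using interval_integral_substitution_finite[of 0 1 "\<lambda>r. a + r * k" "\<lambda>_. k" g, OF _ _ assms]
    by (force intro!: derivative_eq_intros)
  also have "\<dots> = integral {0..1} (\<lambda>r. k *\<^sub>R g (a + r * k))"
    by (intro interval_integral_eq_integral borel_integrable_atLeastAtMost' continuous_intros cont) auto
  also have "\<dots> = of_real k * integral {0..1} (\<lambda>r. g (a + r * k))"
    by (simp add: scaleR_conv_of_real)
  finally show ?thesis .
qed

lemma LBINT_eq_segint:
  assumes "continuous_on {- c..c} g" "x \<in> {- c..c}"
  shows "(LBINT s=0..x. g s) = segint g x"
proof -
  have "continuous_on ((\<lambda>r. 0 + r * x) ` {0..1}) g"
    using assms scaled_in_interval[of x c] by (intro continuous_on_subset[OF assms(1)]) auto
  from LBINT_affine[OF this] show ?thesis by (simp add: segint_def zero_ereal_def)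
qed

lemma segint_cong: "segint g x = segint h x"
  if "\<And>s. s \<in> {- c..c} \<Longrightarrow> g s = h s" "x \<in> {- c..c}"
proof -
  have "integral {0..1} (\<lambda>r. g (r * x)) = integral {0..1} (\<lambda>r. h (r * x))"
    using that(1)[OF scaled_in_interval[OF that(2)]] by (intro integral_cong) auto
  then show ?thesis by (simp add: segint_def)
qed

lemma diagint_cong: "diagint F x = diagint G x"
  if "\<And>u v. (u, v) \<in> diamond c \<Longrightarrow> F u v = G u v" "x \<in> {- c..c}"
proof -
  have "integral {0..1} (\<lambda>r. F (r * x) ((1 - r) * x)) = integral {0..1} (\<lambda>r. G (r * x) ((1 - r) * x))"
    using that(1)[OF diagonal_in_diamond[OF that(2)]] by (intro integral_cong) auto
  then show ?thesis by (simp add: diagint_def)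
qed

lemma segint_integrable:
  fixes g :: "real \<Rightarrow> complex"
  assumes "continuous_on {- c..c} g" "x \<in> {- c..c}"
  shows "(\<lambda>r. g (r * x)) integrable_on {0..1}"
  by (intro integrable_continuous_real continuous_on_compose2[OF assms(1)] continuous_intros)
     (use scaled_in_interval[of x c] assms(2) in auto)

text \<open>The form in which all continuity of functions of two variables is used below: composition with a curve
  or surface that stays in the diamond.\<close>

lemma continuous_on_diamond_compose:
  assumes "continuous_on (diamond c) (\<lambda>(u, v). F u v)" "continuous_on S f" "continuous_on S g"
    and "\<And>z. z \<in> S \<Longrightarrow> (f z, g z) \<in> diamond c"
  shows "continuous_on S (\<lambda>z. F (f z) (g z))"
proof -
  have "continuous_on S (\<lambda>z. (\<lambda>(u, v). F u v) (f z, g z))"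
    by (rule continuous_on_compose2[OF assms(1)]) (use assms in \<open>auto intro!: continuous_intros\<close>)
  then show ?thesis by simp
qed

lemma diagint_integrable:
  fixes F :: "real \<Rightarrow> real \<Rightarrow> complex"
  assumes "continuous_on (diamond c) (\<lambda>(u, v). F u v)" "x \<in> {- c..c}"
  shows "(\<lambda>r. F (r * x) ((1 - r) * x)) integrable_on {0..1}"
proof (rule integrable_continuous_real)
  show "continuous_on {0..1} (\<lambda>r. F (r * x) ((1 - r) * x))"
    by (rule continuous_on_diamond_compose[OF assms(1)])
       (auto intro!: continuous_intros diagonal_in_diamond[OF assms(2)])
qed

lemma segint_0 [simp]: "segint g 0 = 0"
  by (simp add: segint_def)

lemma segint_add:
  assumes "continuous_on {- c..c} g" "continuous_on {- c..c} h" "x \<in> {- c..c}"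
  shows "segint (\<lambda>s. g s + h s) x = segint g x + segint h x"
  unfolding segint_def
  using segint_integrable[OF assms(1,3)] segint_integrable[OF assms(2,3)]
  by (simp add: integral_add distrib_left)

lemma segint_mult_left: "segint (\<lambda>s. a * g s) x = a * segint g x"
  unfolding segint_def by simp

lemma diagint_mult_left: "diagint (\<lambda>u v. a * F u v) x = a * diagint F x"
  unfolding diagint_def by simp

lemma diagint_add:
  assumes "continuous_on (diamond c) (\<lambda>(u, v). F u v)" "continuous_on (diamond c) (\<lambda>(u, v). G u v)"
    and "x \<in> {- c..c}"
  shows "diagint (\<lambda>u v. F u v + G u v) x = diagint F x + diagint G x"
  unfolding diagint_def
  using diagint_integrable[OF assms(1,3)] diagint_integrable[OF assms(2,3)]
  by (simp add: integral_add distrib_left)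

lemma diagint_only_first: "diagint (\<lambda>u v. g u) x = segint g x"
  by (simp add: diagint_def segint_def)

text \<open>The sum of the coordinates is constant on each diagonal, so a factor \<open>q (u + v)\<close> comes out of the integral.\<close>

lemma diagint_mult_sum_arg: "diagint (\<lambda>u v. g (u + v) * F u v) = (\<lambda>x. g x * diagint F x)"
  by (simp add: fun_eq_iff diagint_def algebra_simps)

text \<open>Reversal \<open>r \<mapsto> 1 - r\<close> of the diagonal. Every statement about the second variable below has a mirror
  image obtained through this symmetry.\<close>

lemma diagint_swap:
  assumes "continuous_on (diamond c) (\<lambda>(u, v). F u v)" "x \<in> {- c..c}"
  shows "diagint (\<lambda>u v. F v u) x = diagint F x"
proof -
  have img: "(\<lambda>r. 1 - r) ` {0..1} = {0..1::real}"
    by (auto simp: image_iff intro!: bexI[of _ "1 - r" for r])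
  have "((\<lambda>r. F (r * x) ((1 - r) * x)) has_integral integral {0..1} (\<lambda>r. F (r * x) ((1 - r) * x))) {0..1}"
    using diagint_integrable[OF assms] by (rule integrable_integral)
  from has_integral_affinity01[OF this, of "-1" 1]
  have "integral {0..1} (\<lambda>r. F ((1 - r) * x) (r * x)) = integral {0..1} (\<lambda>r. F (r * x) ((1 - r) * x))"
    by (intro integral_unique) (simp add: img)
  then show ?thesis by (simp add: diagint_def)
qed

lemma continuous_on_swap_diamond:
  "continuous_on (diamond b) (\<lambda>(u, v). F u v) \<Longrightarrow> continuous_on (diamond b) (\<lambda>(u, v). F v u)"
  unfolding case_prod_beta
  by (rule continuous_on_diamond_compose[where c = b]) (auto intro!: continuous_intros simp: diamond_def case_prod_beta)

lemma continuous_on_diagint: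
  assumes "continuous_on (diamond b) (\<lambda>(u, v). F u v)"
  shows "continuous_on {- b..b} (diagint F)"
  unfolding diagint_def cbox_interval[symmetric]
proof (intro continuous_intros integral_continuous_on_param)
  have "(s * x, (1 - s) * x) \<in> diamond b" if "- b \<le> x" "x \<le> b" "0 \<le> s" "s \<le> 1" for s x
    using diagonal_in_diamond[of x b s] that by simp
  then show "continuous_on (cbox (- b) b \<times> cbox 0 1) (\<lambda>(x, r). F (r * x) ((1 - r) * x))"
    unfolding case_prod_beta
    by (intro continuous_on_diamond_compose[OF assms] continuous_intros) auto
qed

lemma continuous_on_segint_param:
  assumes "continuous_on (diamond b) (\<lambda>(u, v). F u v)"
  shows "continuous_on (diamond b) (\<lambda>(u, v). segint (F u) v)"
  unfolding segint_def cbox_interval[symmetric] case_prod_beta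
proof (intro continuous_intros integral_continuous_on_param)
  have "(u, s * v) \<in> diamond b" if "(u, v) \<in> diamond b" "0 \<le> s" "s \<le> 1" for u v s
    using scaled_in_diamond[OF that(1), of 1 s] that by simp
  then show "continuous_on (diamond b \<times> cbox 0 1) (\<lambda>(w, r). F (fst w) (r * snd w))"
    unfolding case_prod_beta
    by (intro continuous_on_diamond_compose[OF assms] continuous_intros) auto
qed

lemma continuous_on_segint_param':
  assumes "continuous_on (diamond b) (\<lambda>(u, v). F u v)"
  shows "continuous_on (diamond b) (\<lambda>(u, v). segint (\<lambda>\<alpha>. F \<alpha> v) u)"
  using continuous_on_swap_diamond[OF continuous_on_segint_param[OF continuous_on_swap_diamond[OF assms]]] .

section \<open>Fubini on a triangle and derivatives of diagonal integrals\<close>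

lemma integral_affine:
  fixes g :: "real \<Rightarrow> complex" and a k :: real
  assumes "continuous_on {a..a + k} g" "0 \<le> k"
  shows "integral {a..a + k} g = of_real k * integral {0..1} (\<lambda>r. g (a + r * k))"
proof -
  have "continuous_on ((\<lambda>r. a + r * k) ` {0..1}) g"
    using mult_left_le_one_le[of k] assms(2) by (intro continuous_on_subset[OF assms(1)]) auto
  from LBINT_affine[OF this] show ?thesis
    using interval_integral_eq_integral[OF _ borel_integrable_atLeastAtMost'[OF assms(1)]] assms(2)
    by simp
qed

text \<open>Fubini for the indicator of the triangle times \<open>\<Phi>\<close>; this product is Lebesgue integrable on the plane
  because the triangle is compact and \<open>\<Phi>\<close> is continuous there.\<close>

lemma integral_triangle_swap:
  fixes \<Phi> :: "real \<Rightarrow> real \<Rightarrow> complex"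
  assumes "continuous_on {(s, y). 0 \<le> s \<and> s \<le> y \<and> y \<le> 1} (\<lambda>(s, y). \<Phi> s y)"
  shows "integral {0..1} (\<lambda>y. integral {0..y} (\<lambda>s. \<Phi> s y)) =
         integral {0..1} (\<lambda>s. integral {s..1} (\<lambda>y. \<Phi> s y))"
proof -
  \<comment> \<open>The indicator is kept inside the integrand, so both iterated integrals run over the whole line.\<close>
  define T :: "(real \<times> real) set" where "T = {(s, y). 0 \<le> s \<and> s \<le> y \<and> y \<le> 1}"
  define f where "f s y = indicator T (s, y) *\<^sub>R \<Phi> s y" for s y
  have cont: "continuous_on T (\<lambda>(s, y). \<Phi> s y)"
    using assms by (simp add: T_def)
  have "closed T"
    unfolding T_def case_prod_beta by (intro closed_Collect_conj closed_Collect_le continuous_intros)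
  moreover have "T \<subseteq> cbox (0, 0) (1, 1)"
    by (auto simp: T_def cbox_Pair_eq)
  ultimately have "compact T"
    using compact_cbox compact_eq_bounded_closed bounded_subset bounded_cbox by metis
  from borel_integrable_compact[OF this cont]
  have int: "integrable (lborel \<Otimes>\<^sub>M lborel) (case_prod f)"
    unfolding lborel_prod f_def by (simp add: case_prod_beta')
  have slice: "(\<integral>s. indicator A s *\<^sub>R \<Phi> s y \<partial>lborel) = integral A (\<lambda>s. \<Phi> s y)"
    if "A = {0..y}" "y \<in> {0..1}" for A y
  proof -
    have "continuous_on A (\<lambda>s. (\<lambda>(s, y). \<Phi> s y) (s, y))"
      by (rule continuous_on_compose2[OF cont]) (use that in \<open>auto simp: T_def intro!: continuous_intros\<close>)
    then have "set_integrable lborel A (\<lambda>s. \<Phi> s y)"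
      unfolding \<open>A = _\<close> by (intro borel_integrable_atLeastAtMost') simp
    from set_borel_integral_eq_integral[OF this] show ?thesis
      by (simp add: set_lebesgue_integral_def)
  qed
  have slice': "(\<integral>y. indicator A y *\<^sub>R \<Phi> s y \<partial>lborel) = integral A (\<lambda>y. \<Phi> s y)"
    if "A = {s..1}" "s \<in> {0..1}" for A s
  proof -
    have "continuous_on A (\<lambda>y. (\<lambda>(s, y). \<Phi> s y) (s, y))"
      by (rule continuous_on_compose2[OF cont]) (use that in \<open>auto simp: T_def intro!: continuous_intros\<close>)
    then have "set_integrable lborel A (\<lambda>y. \<Phi> s y)"
      unfolding \<open>A = _\<close> by (intro borel_integrable_atLeastAtMost') simp
    from set_borel_integral_eq_integral[OF this] show ?thesis
      by (simp add: set_lebesgue_integral_def)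
  qed
  have 1: "(\<integral>s. f s y \<partial>lborel) = indicator {0..1} y *\<^sub>R integral {0..y} (\<lambda>s. \<Phi> s y)" for y
  proof (cases "y \<in> {0..1}")
    case True
    then have "(\<lambda>s. f s y) = (\<lambda>s. indicator {0..y} s *\<^sub>R \<Phi> s y)"
      by (auto simp: f_def T_def indicator_def)
    with slice[OF refl True] True show ?thesis by simp
  next
    case False
    then have "(\<lambda>s. f s y) = (\<lambda>s. 0)"
      by (auto simp: f_def T_def indicator_def)
    with False show ?thesis by simp
  qed
  have 2: "(\<integral>y. f s y \<partial>lborel) = indicator {0..1} s *\<^sub>R integral {s..1} (\<lambda>y. \<Phi> s y)" for s
  proof (cases "s \<in> {0..1}")
    case True
    then have "(\<lambda>y. f s y) = (\<lambda>y. indicator {s..1} y *\<^sub>R \<Phi> s y)"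
      by (auto simp: f_def T_def indicator_def)
    with slice'[OF refl True] True show ?thesis by simp
  next
    case False
    then have "(\<lambda>y. f s y) = (\<lambda>y. 0)"
      by (auto simp: f_def T_def indicator_def)
    with False show ?thesis by simp
  qed
  have "set_integrable lborel {0..1} (\<lambda>y. integral {0..y} (\<lambda>s. \<Phi> s y))"
    using lborel_pair.integrable_snd[OF int] by (simp add: 1 set_integrable_def)
  from set_borel_integral_eq_integral(2)[OF this]
  have L: "(\<integral>y. \<integral>s. f s y \<partial>lborel \<partial>lborel) = integral {0..1} (\<lambda>y. integral {0..y} (\<lambda>s. \<Phi> s y))"
    by (simp add: 1 set_lebesgue_integral_def)
  have "set_integrable lborel {0..1} (\<lambda>s. integral {s..1} (\<lambda>y. \<Phi> s y))"
    using lborel_pair.integrable_fst[OF int] by (simp add: 2 set_integrable_def)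
  from set_borel_integral_eq_integral(2)[OF this]
  have R: "(\<integral>s. \<integral>y. f s y \<partial>lborel \<partial>lborel) = integral {0..1} (\<lambda>s. integral {s..1} (\<lambda>y. \<Phi> s y))"
    by (simp add: 2 set_lebesgue_integral_def)
  show ?thesis
    using lborel_pair.Fubini_integral[OF int] L R by simp
qed

text \<open>Both sides integrate \<open>F\<close> over the triangle with vertices \<open>(0, 0)\<close>, \<open>(x, 0)\<close>, \<open>(0, x)\<close>, on the left by
  diagonals and on the right by vertical segments. Rescaling by \<open>x\<close> reduces this to the unit triangle
  whatever the sign of \<open>x\<close>.\<close>

lemma segint_diagint:
  assumes cont: "continuous_on (diamond b) (\<lambda>(u, v). F u v)" and x: "x \<in> {- b..b}"
  shows "segint (diagint F) x = diagint (\<lambda>u v. segint (F u) v) x"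
proof -
  define \<Phi> where "\<Phi> s y = F (s * x) ((y - s) * x)" for s y
  have mem: "(s * x, (y - s) * x) \<in> diamond b" if "0 \<le> s" "s \<le> y" "y \<le> 1" for s y
  proof -
    have "\<bar>s * x\<bar> + \<bar>(y - s) * x\<bar> = (s + (y - s)) * \<bar>x\<bar>"
      using that by (simp only: abs_mult distrib_right)
    then show ?thesis using that x mult_left_le_one_le[of "\<bar>x\<bar>" y] by (auto simp: diamond_def)
  qed
  have cont2: "continuous_on {(s, y). 0 \<le> s \<and> s \<le> y \<and> y \<le> 1} (\<lambda>(s, y). \<Phi> s y)"
    unfolding \<Phi>_def case_prod_beta
    by (intro continuous_on_diamond_compose[OF cont] continuous_intros) (auto intro: mem)
  have 1: "integral {0..y} (\<lambda>s. \<Phi> s y) = of_real y * integral {0..1} (\<lambda>r. \<Phi> (r * y) y)"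
    if "y \<in> {0..1}" for y
  proof -
    have "continuous_on {0..0 + y} (\<lambda>s. \<Phi> s y)"
      unfolding \<Phi>_def
      by (intro continuous_on_diamond_compose[OF cont] continuous_intros) (auto intro!: mem simp: that[simplified])
    from integral_affine[OF this] show ?thesis using that by simp
  qed
  have 2: "integral {s..1} (\<lambda>y. \<Phi> s y) = of_real (1 - s) * integral {0..1} (\<lambda>r. \<Phi> s (s + r * (1 - s)))"
    if "s \<in> {0..1}" for s
  proof -
    have "continuous_on {s..s + (1 - s)} (\<lambda>y. \<Phi> s y)"
      unfolding \<Phi>_def
      by (intro continuous_on_diamond_compose[OF cont] continuous_intros) (auto intro!: mem simp: that[simplified])
    from integral_affine[OF this] show ?thesis using that by simp
  qed
  have "segint (diagint F) x = of_real x * (of_real x * integral {0..1}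
          (\<lambda>y. of_real y * integral {0..1} (\<lambda>r. \<Phi> (r * y) y)))"
  proof -
    have "(\<lambda>y. diagint F (y * x)) =
        (\<lambda>y. of_real x * (of_real y * integral {0..1} (\<lambda>r. \<Phi> (r * y) y)))"
      by (simp add: diagint_def \<Phi>_def algebra_simps)
    then show ?thesis
      unfolding segint_def by (simp only: integral_mult_right)
  qed
  also have "\<dots> = of_real x * (of_real x * integral {0..1} (\<lambda>y. integral {0..y} (\<lambda>s. \<Phi> s y)))"
    by (intro arg_cong2[of _ _ _ _ "(*)"] refl integral_cong) (simp only: 1)
  also have "\<dots> = of_real x * (of_real x * integral {0..1} (\<lambda>s. integral {s..1} (\<lambda>y. \<Phi> s y)))"
    using integral_triangle_swap[OF cont2] by simp
  also have "\<dots> = of_real x * (of_real x * integral {0..1}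
          (\<lambda>s. of_real (1 - s) * integral {0..1} (\<lambda>r. \<Phi> s (s + r * (1 - s)))))"
    by (intro arg_cong2[of _ _ _ _ "(*)"] refl integral_cong) (simp only: 2)
  also have "\<dots> = diagint (\<lambda>u v. segint (F u) v) x"
  proof -
    have "(\<lambda>s. segint (F (s * x)) ((1 - s) * x)) =
        (\<lambda>s. of_real x * (of_real (1 - s) * integral {0..1} (\<lambda>r. \<Phi> s (s + r * (1 - s)))))"
      by (simp add: segint_def \<Phi>_def algebra_simps)
    then show ?thesis
      unfolding diagint_def by (simp only: integral_mult_right)
  qed
  finally show ?thesis .
qed

lemma segint_diagint':
  assumes "continuous_on (diamond b) (\<lambda>(u, v). F u v)" "x \<in> {- b..b}"
  shows "segint (diagint F) x = diagint (\<lambda>u v. segint (\<lambda>\<alpha>. F \<alpha> v) u) x"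
proof -
  note cont' = continuous_on_swap_diamond[OF assms(1)]
  have "segint (diagint F) x = segint (diagint (\<lambda>u v. F v u)) x"
    using assms(2) by (intro segint_cong diagint_swap[OF assms(1), symmetric])
  also have "\<dots> = diagint (\<lambda>u v. segint (\<lambda>\<beta>. F \<beta> u) v) x"
    by (rule segint_diagint[OF cont' assms(2)])
  also have "\<dots> = diagint (\<lambda>u v. segint (\<lambda>\<alpha>. F \<alpha> v) u) x"
    by (rule diagint_swap[OF continuous_on_segint_param[OF cont'] assms(2), symmetric])
  finally show ?thesis .
qed

text \<open>Fubini on the rectangle spanned by the origin and \<open>(u, v)\<close>.\<close>

lemma segint_segint_swap:
  assumes "continuous_on (diamond b) (\<lambda>(u, v). F u v)" "(u, v) \<in> diamond b"
  shows "segint (\<lambda>\<alpha>. segint (F \<alpha>) v) u = segint (\<lambda>\<beta>. segint (\<lambda>\<alpha>. F \<alpha> \<beta>) u) v"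
proof -
  have "continuous_on (cbox (0, 0) (1, 1)) (\<lambda>(r, s). F (r * u) (s * v))"
    unfolding case_prod_beta
    by (intro continuous_on_diamond_compose[OF assms(1)] continuous_intros)
       (use scaled_in_diamond[OF assms(2)] in \<open>auto simp: cbox_Pair_eq\<close>)
  from integral_swap_continuous[OF this]
  have "integral {0..1} (\<lambda>r. integral {0..1} (\<lambda>s. F (r * u) (s * v))) =
        integral {0..1} (\<lambda>s. integral {0..1} (\<lambda>r. F (r * u) (s * v)))"
    by simp
  then show ?thesis by (simp add: segint_def)
qed

lemma segint_has_vector_derivative:
  assumes "continuous_on {- c..c} g" "x \<in> {- c..c}"
  shows "(segint g has_vector_derivative g x) (at x within {- c..c})"
proof -
  have "((\<lambda>x. LBINT s=0..x. g s) has_vector_derivative g x) (at x within {- c..c})"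
    using interval_integral_FTC2[of "-c" 0 c g x] assms by (auto simp: zero_ereal_def)
  then show ?thesis
    by (rule has_vector_derivative_transform[OF assms(2) LBINT_eq_segint[OF assms(1), symmetric], rotated])
qed

lemma continuous_on_segint: "continuous_on {- c..c} g \<Longrightarrow> continuous_on {- c..c} (segint g)"
  by (meson continuous_on_vector_derivative segint_has_vector_derivative)

lemma segint_derivative:
  assumes deriv: "\<And>x. x \<in> {- c..c} \<Longrightarrow> (g has_vector_derivative g' x) (at x within {- c..c})"
    and cont: "continuous_on {- c..c} g'" and x: "x \<in> {- c..c}"
  shows "g x = g 0 + segint g' x"
proof -
  have "((\<lambda>x. g x - segint g' x) has_vector_derivative 0) (at x within {- c..c})" if "x \<in> {- c..c}" for x
    using has_vector_derivative_diff[OF deriv[OF that] segint_has_vector_derivative[OF cont that]] by simp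
  then obtain d where d: "\<And>x. x \<in> {- c..c} \<Longrightarrow> g x - segint g' x = d"
    using has_vector_derivative_zero_constant[of "{- c..c}" "\<lambda>x. g x - segint g' x"] by auto
  from d[OF x] d[of 0] x show ?thesis by (simp add: algebra_simps)
qed

text \<open>Leibniz rule without differentiation under the integral sign: writing
  \<open>N (u, v) = N (u, 0) + \<integral>\<^sub>0\<^sup>v N' (u, \<beta>) d\<beta>\<close> and recombining the double integral by
  diagonals, \<open>diagint N\<close> becomes an antiderivative of the claimed derivative. In this way only the
  one-sided partial derivatives on the slices of the diamond are needed, which is all that exists at its boundary.\<close>

lemma diagint_has_vector_derivative_snd:
  assumes N: "continuous_on (diamond b) (\<lambda>(u, v). N u v)"
    and N': "continuous_on (diamond b) (\<lambda>(u, v). N' u v)"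
    and deriv: "\<And>u v. (u, v) \<in> diamond b \<Longrightarrow>
        (N u has_vector_derivative N' u v) (at v within {- (b - \<bar>u\<bar>)..b - \<bar>u\<bar>})"
    and x: "x \<in> {- b..b}"
  shows "(diagint N has_vector_derivative N x 0 + diagint N' x) (at x within {- b..b})"
proof -
  have cont0: "continuous_on {- b..b} (\<lambda>u. N u 0)"
    by (intro continuous_on_diamond_compose[OF N] continuous_intros axes_in_diamond)
  have *: "N u v = N u 0 + segint (N' u) v" if "(u, v) \<in> diamond b" for u v
  proof (rule segint_derivative)
    show "v \<in> {- (b - \<bar>u\<bar>)..b - \<bar>u\<bar>}" using that by (auto simp: diamond_def)
    show "continuous_on {- (b - \<bar>u\<bar>)..b - \<bar>u\<bar>} (N' u)"
      by (intro continuous_on_diamond_compose[OF N'] continuous_intros) (auto simp: diamond_def)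
    show "(N u has_vector_derivative N' u y) (at y within {- (b - \<bar>u\<bar>)..b - \<bar>u\<bar>})"
      if "y \<in> {- (b - \<bar>u\<bar>)..b - \<bar>u\<bar>}" for y
      using that by (intro deriv) (auto simp: diamond_def)
  qed
  have "diagint N x = segint (\<lambda>u. N u 0) x + segint (diagint N') x" if x: "x \<in> {- b..b}" for x
  proof -
    have "diagint N x = diagint (\<lambda>u v. N u 0 + segint (N' u) v) x"
      using * x by (rule diagint_cong)
    also have "\<dots> = diagint (\<lambda>u v. N u 0) x + diagint (\<lambda>u v. segint (N' u) v) x"
    proof (rule diagint_add[OF _ continuous_on_segint_param[OF N'] x])
      show "continuous_on (diamond b) (\<lambda>(u, v). N u 0)"
        unfolding case_prod_beta
        by (intro continuous_on_compose2[OF cont0] continuous_intros) (auto simp: diamond_def)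
    qed
    finally show ?thesis
      by (simp add: diagint_only_first segint_diagint[OF N' x])
  qed
  then show ?thesis
    by (rule has_vector_derivative_transform[OF x _ has_vector_derivative_add[OF
          segint_has_vector_derivative[OF cont0 x]
          segint_has_vector_derivative[OF continuous_on_diagint[OF N'] x]]])
qed

lemma diagint_has_vector_derivative_fst:
  assumes N: "continuous_on (diamond b) (\<lambda>(u, v). N u v)"
    and N': "continuous_on (diamond b) (\<lambda>(u, v). N' u v)"
    and deriv: "\<And>u v. (u, v) \<in> diamond b \<Longrightarrow>
        ((\<lambda>u. N u v) has_vector_derivative N' u v) (at u within {- (b - \<bar>v\<bar>)..b - \<bar>v\<bar>})"
    and x: "x \<in> {- b..b}"
  shows "(diagint N has_vector_derivative N 0 x + diagint N' x) (at x within {- b..b})"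
proof -
  have "(diagint (\<lambda>u v. N v u) has_vector_derivative N 0 x + diagint (\<lambda>u v. N' v u) x) (at x within {- b..b})"
    by (rule diagint_has_vector_derivative_snd[OF
          continuous_on_swap_diamond[OF N] continuous_on_swap_diamond[OF N'] _ x], rule deriv)
       (simp add: diamond_def add.commute)
  then show ?thesis
    unfolding diagint_swap[OF N' x]
    by (rule has_vector_derivative_transform[OF x, rotated]) (simp add: diagint_swap[OF N])
qed

section \<open>Smoothness and iterates of the generalized derivative\<close>

lemma nderiv_0 [simp]: "nderiv S 0 g = g"
  by (simp add: nderiv_def)

lemma nderiv_Suc: "nderiv S (Suc n) g = nderiv S n (nderiv S 1 g)"
  by (simp add: nderiv_def funpow_Suc_right del: funpow.simps)

lemma nderiv_1: "nderiv S 1 g x = vector_derivative g (at x within S)"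
  by (simp add: nderiv_def)

lemma nderiv_1_eqI:
  assumes "0 < b" "x \<in> {- b..b}" "(g has_vector_derivative g') (at x within {- b..b})"
  shows "nderiv {- b..b} 1 g x = g'"
  using vector_derivative_within_closed_interval[of "- b" b x g g'] assms unfolding nderiv_1 by auto

text \<open>Derivatives within \<open>S\<close> see only the values on \<open>S\<close>. This is needed because all identities hold only on the
  interval, while the functions involved are total.\<close>

lemma nderiv_1_cong:
  assumes "\<And>x. x \<in> S \<Longrightarrow> g x = h x" "x \<in> S"
  shows "nderiv S 1 g x = nderiv S 1 h x"
proof -
  have "(g has_vector_derivative d) (at x within S) \<longleftrightarrow> (h has_vector_derivative d) (at x within S)" for d
    using has_vector_derivative_transform[OF assms(2), of g h] has_vector_derivative_transform[OF assms(2), of h g]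
      assms(1) by auto
  then show ?thesis unfolding nderiv_1 vector_derivative_def by simp
qed

lemma C_on_0: "C_on 0 S g \<longleftrightarrow> continuous_on S g"
  by (simp add: C_on_def)

lemma C_on_Suc:
  "C_on (Suc k) S g \<longleftrightarrow> (\<forall>x\<in>S. g differentiable (at x within S)) \<and> C_on k S (nderiv S 1 g)"
  unfolding C_on_def All_less_Suc2 nderiv_Suc by auto

lemma C_on_cong:
  assumes "\<And>x. x \<in> S \<Longrightarrow> g x = h x"
  shows "C_on k S g \<longleftrightarrow> C_on k S h"
  using assms
proof (induction k arbitrary: g h)
  case 0
  then show ?case by (simp add: C_on_0 cong: continuous_on_cong)
next
  case (Suc k)
  have "g differentiable (at x within S) \<longleftrightarrow> h differentiable (at x within S)" if "x \<in> S" for x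
    unfolding differentiable_def
    using has_derivative_transform[OF that, of g h] has_derivative_transform[OF that, of h g] Suc.prems by metis
  moreover have "C_on k S (nderiv S 1 g) \<longleftrightarrow> C_on k S (nderiv S 1 h)"
    using nderiv_1_cong[of S g h] Suc.prems by (intro Suc.IH) auto
  ultimately show ?case by (auto simp: C_on_Suc)
qed

lemma C_on_SucD: "C_on (Suc k) S g \<Longrightarrow> C_on k S g"
proof (induction k arbitrary: g)
  case 0
  then show ?case
    by (auto simp: C_on_Suc C_on_0 continuous_on_eq_continuous_within intro: differentiable_imp_continuous_within)
next
  case (Suc k)
  then show ?case unfolding C_on_Suc[of "Suc k"] C_on_Suc[of k] by blast
qed

lemma C_on_le: "C_on k S g \<Longrightarrow> j \<le> k \<Longrightarrow> C_on j S g"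
  by (induction k) (auto simp: le_Suc_eq dest: C_on_SucD)

lemma C_on_imp_continuous_on: "C_on k S g \<Longrightarrow> continuous_on S g"
  using C_on_le[of k S g 0] by (simp add: C_on_0)

lemma C_on_Suc_has_vector_derivative:
  "C_on (Suc k) S g \<Longrightarrow> x \<in> S \<Longrightarrow> (g has_vector_derivative nderiv S 1 g x) (at x within S)"
  by (auto simp: C_on_Suc nderiv_1 vector_derivative_works simp del: One_nat_def)

lemma C_on_SucI:
  assumes "0 < b" "\<And>x. x \<in> {- b..b} \<Longrightarrow> (g has_vector_derivative g' x) (at x within {- b..b})"
    and "C_on k {- b..b} g'"
  shows "C_on (Suc k) {- b..b} g"
proof -
  have "C_on k {- b..b} (nderiv {- b..b} 1 g)"
    using nderiv_1_eqI[OF assms(1) _ assms(2)] assms(3) by (subst C_on_cong[of _ _ g']) auto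
  then show ?thesis
    using assms(2) differentiableI_vector unfolding C_on_Suc by blast
qed

lemma C_on_const:
  assumes "0 < b" shows "C_on k {- b..b} (\<lambda>_. c)"
proof (induction k arbitrary: c)
  case (Suc k)
  show ?case by (rule C_on_SucI[OF assms _ Suc]) (auto intro!: derivative_eq_intros)
qed (auto simp: C_on_0)

lemma C_on_add:
  assumes "0 < b" "C_on k {- b..b} g" "C_on k {- b..b} h"
  shows "C_on k {- b..b} (\<lambda>x. g x + h x)"
  using assms(2,3)
proof (induction k arbitrary: g h)
  case (Suc k)
  show ?case
    by (rule C_on_SucI[OF assms(1) has_vector_derivative_add[OF
          C_on_Suc_has_vector_derivative[OF Suc.prems(1)] C_on_Suc_has_vector_derivative[OF Suc.prems(2)]]])
       (use Suc in \<open>auto simp: C_on_Suc\<close>)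
qed (auto simp: C_on_0 intro: continuous_intros)

lemma C_on_mult:
  assumes "0 < b" "C_on k {- b..b} g" "C_on k {- b..b} h"
  shows "C_on k {- b..b} (\<lambda>x. g x * h x)"
  using assms(2,3)
proof (induction k arbitrary: g h)
  case (Suc k)
  show ?case
    by (rule C_on_SucI[OF assms(1) has_vector_derivative_mult[OF
          C_on_Suc_has_vector_derivative[OF Suc.prems(1)] C_on_Suc_has_vector_derivative[OF Suc.prems(2)]]])
       (use Suc in \<open>auto simp: C_on_Suc intro!: C_on_add assms Suc.IH C_on_SucD[OF Suc.prems(1)] C_on_SucD[OF Suc.prems(2)]\<close>)
qed (auto simp: C_on_0 intro: continuous_intros)

lemma C_on_lincomb:
  assumes "0 < b" "C_on k {- b..b} g" "C_on k {- b..b} h"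
  shows "C_on k {- b..b} (\<lambda>x. c * g x + d * h x)"
  using assms by (intro C_on_add C_on_mult C_on_const)

lemma C_on_segint:
  assumes "0 < b" "C_on k {- b..b} g"
  shows "C_on (Suc k) {- b..b} (segint g)"
  using C_on_SucI[OF assms(1) segint_has_vector_derivative assms(2)] C_on_imp_continuous_on[OF assms(2)] by auto

lemma gamma21_cong:
  assumes "0 < b" "\<And>x. x \<in> {- b..b} \<Longrightarrow> g x = h x" "x \<in> {- b..b}"
  shows "gamma21 b q g x = gamma21 b q h x"
proof -
  have "(LBINT s=0..x. q s * g s) = (LBINT s=0..x. q s * h s)"
    using assms(2,3)
    by (intro interval_integral_cong) (auto simp: einterval_iff zero_ereal_def min_def max_def split: if_splits)
  moreover have "nderiv {- b..b} 1 g y = nderiv {- b..b} 1 h y" if "y \<in> {- b..b}" for y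
    using assms(2) that by (rule nderiv_1_cong)
  ultimately show ?thesis using assms by (simp add: gamma21_def)
qed

lemma gamma21_pow_cong:
  assumes "0 < b" "\<And>x. x \<in> {- b..b} \<Longrightarrow> g x = h x" "x \<in> {- b..b}"
  shows "(gamma21 b q ^^ n) g x = (gamma21 b q ^^ n) h x"
  using assms(2,3)
proof (induction n arbitrary: x)
  case (Suc n)
  then show ?case using gamma21_cong[OF assms(1) Suc.IH] by simp
qed simp

lemma gamma21_exists_cong:
  assumes "0 < b" "\<And>x. x \<in> {- b..b} \<Longrightarrow> g x = h x"
  shows "gamma21_exists b q n g \<longleftrightarrow> gamma21_exists b q n h"
proof (induction n)
  case (Suc n)
  have "C_on 1 {- b..b} ((gamma21 b q ^^ n) g) \<longleftrightarrow> C_on 1 {- b..b} ((gamma21 b q ^^ n) h)"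
    using gamma21_pow_cong[OF assms] by (rule C_on_cong)
  with Suc show ?case by simp
qed simp

lemma gamma21_exists_Suc_iff:
  "gamma21_exists b q (Suc n) g \<longleftrightarrow> C_on 1 {- b..b} g \<and> gamma21_exists b q n (gamma21 b q g)"
proof (induction n)
  case (Suc n)
  then show ?case
    by (simp only: gamma21_exists.simps(2)[of b q "Suc n"] gamma21_exists.simps(2)[of b q n "gamma21 b q g"]
        funpow_Suc_right o_apply conj_assoc)
qed simp

lemma gamma21_eq:
  assumes "0 < b" "continuous_on {- b..b} q" "continuous_on {- b..b} g" "x \<in> {- b..b}"
    and "\<And>y. y \<in> {- b..b} \<Longrightarrow> (g has_vector_derivative g' y) (at y within {- b..b})"
  shows "gamma21 b q g x = (g' x - g' 0 - segint (\<lambda>s. q s * g s) x) / 2"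
proof -
  have "nderiv {- b..b} 1 g y = g' y" if "y \<in> {- b..b}" for y
    using nderiv_1_eqI[OF assms(1) that assms(5)[OF that]] .
  moreover have "(LBINT s=0..x. q s * g s) = segint (\<lambda>s. q s * g s) x"
    using assms by (intro LBINT_eq_segint continuous_intros)
  ultimately show ?thesis using assms by (simp add: gamma21_def)
qed

lemma gamma21_lincomb:
  assumes "0 < b" "continuous_on {- b..b} q" "C_on 1 {- b..b} g" "C_on 1 {- b..b} h" "x \<in> {- b..b}"
  shows "gamma21 b q (\<lambda>x. c * g x + d * h x) x = c * gamma21 b q g x + d * gamma21 b q h x"
proof -
  define S where "S = {- b..b}"
  have D: "(g has_vector_derivative nderiv S 1 g y) (at y within S)"
    "(h has_vector_derivative nderiv S 1 h y) (at y within S)" if "y \<in> S" for y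
    using C_on_Suc_has_vector_derivative[of 0 S] assms(3,4) that by (auto simp: S_def)
  have cont: "continuous_on S g" "continuous_on S h"
    using assms C_on_imp_continuous_on by (auto simp: S_def)
  have "gamma21 b q (\<lambda>x. c * g x + d * h x) x =
      (c * nderiv S 1 g x + d * nderiv S 1 h x - (c * nderiv S 1 g 0 + d * nderiv S 1 h 0)
       - segint (\<lambda>s. q s * (c * g s + d * h s)) x) / 2"
    using assms cont unfolding S_def[symmetric]
    by (intro gamma21_eq[where b = b, folded S_def] continuous_intros has_vector_derivative_add
        has_vector_derivative_mult_right D) auto
  also have "segint (\<lambda>s. q s * (c * g s + d * h s)) x = segint (\<lambda>s. c * (q s * g s) + d * (q s * h s)) x"
    by (simp add: algebra_simps)
  also have "\<dots> = c * segint (\<lambda>s. q s * g s) x + d * segint (\<lambda>s. q s * h s) x"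
    using assms(2,5) cont unfolding S_def
    by (subst segint_add) (auto intro!: continuous_intros simp: segint_mult_left)
  also have "(c * nderiv S 1 g x + d * nderiv S 1 h x - (c * nderiv S 1 g 0 + d * nderiv S 1 h 0)
       - (c * segint (\<lambda>s. q s * g s) x + d * segint (\<lambda>s. q s * h s) x)) / 2 =
      c * ((nderiv S 1 g x - nderiv S 1 g 0 - segint (\<lambda>s. q s * g s) x) / 2) +
      d * ((nderiv S 1 h x - nderiv S 1 h 0 - segint (\<lambda>s. q s * h s) x) / 2)"
    by (simp add: field_simps)
  finally have "gamma21 b q (\<lambda>x. c * g x + d * h x) x = \<dots>" .
  moreover have "gamma21 b q g x = (nderiv S 1 g x - nderiv S 1 g 0 - segint (\<lambda>s. q s * g s) x) / 2"
    using assms cont D unfolding S_def by (intro gamma21_eq)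
  moreover have "gamma21 b q h x = (nderiv S 1 h x - nderiv S 1 h 0 - segint (\<lambda>s. q s * h s) x) / 2"
    using assms cont D unfolding S_def by (intro gamma21_eq)
  ultimately show ?thesis by (simp only:)
qed

text \<open>Existence has to accompany linearity at every step, because the derivative of a sum splits only when
  both summands are differentiable.\<close>

lemma gamma21_pow_lincomb:
  assumes "0 < b" "continuous_on {- b..b} q" "gamma21_exists b q n g" "gamma21_exists b q n h"
  shows "gamma21_exists b q n (\<lambda>x. c * g x + d * h x) \<and>
    (\<forall>x\<in>{- b..b}. (gamma21 b q ^^ n) (\<lambda>x. c * g x + d * h x) x =
        c * (gamma21 b q ^^ n) g x + d * (gamma21 b q ^^ n) h x)"
  using assms(3,4)
proof (induction n)
  case (Suc n)
  let ?G = "gamma21 b q ^^ n" and ?S = "{- b..b}"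
  have IH: "gamma21_exists b q n (\<lambda>x. c * g x + d * h x)"
     "\<And>x. x \<in> ?S \<Longrightarrow> ?G (\<lambda>x. c * g x + d * h x) x = c * ?G g x + d * ?G h x"
    using Suc by auto
  have C1: "C_on 1 ?S (?G g)" "C_on 1 ?S (?G h)"
    using Suc.prems by auto
  have "C_on 1 ?S (?G (\<lambda>x. c * g x + d * h x))"
    using C_on_lincomb[OF assms(1) C1, of c d] IH(2) by (subst C_on_cong) auto
  moreover have "gamma21 b q (?G (\<lambda>x. c * g x + d * h x)) x =
      c * gamma21 b q (?G g) x + d * gamma21 b q (?G h) x" if "x \<in> ?S" for x
    using gamma21_cong[OF assms(1) IH(2) that] gamma21_lincomb[OF assms(1,2) C1 that, of c d] by simp
  ultimately show ?case using IH(1) by simp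
qed simp

text \<open>The generalized derivative costs one derivative as long as the order of \<open>g\<close> is at most \<open>p + 2\<close>: the integral of
  \<open>q g\<close> gains one derivative back, so \<open>q\<close> has to be only \<open>k - 1\<close> times differentiable.\<close>

lemma C_on_gamma21:
  assumes "0 < b" "C_on p {- b..b} q" "C_on (Suc k) {- b..b} g" "k \<le> p + 1"
  shows "C_on k {- b..b} (gamma21 b q g)"
proof -
  let ?S = "{- b..b}"
  have "C_on k ?S (segint (\<lambda>s. q s * g s))"
  proof (cases k)
    case 0
    have "continuous_on ?S (\<lambda>s. q s * g s)"
      using assms by (intro continuous_intros C_on_imp_continuous_on)
    then show ?thesis using continuous_on_segint 0 by (simp add: C_on_0)
  next
    case (Suc i)
    have "C_on i ?S q" "C_on i ?S g"
      using assms Suc by (auto intro: C_on_le)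
    then show ?thesis
      unfolding Suc by (intro C_on_segint C_on_mult assms)
  qed
  moreover have "C_on k ?S (\<lambda>x. nderiv ?S 1 g x + (- nderiv ?S 1 g 0))"
    using assms by (intro C_on_add C_on_const) (auto simp: C_on_Suc)
  ultimately have "C_on k ?S (\<lambda>x. (1 / 2) * (nderiv ?S 1 g x + (- nderiv ?S 1 g 0)) + (- 1 / 2) * segint (\<lambda>s. q s * g s) x)"
    by (intro C_on_lincomb assms)
  moreover have "gamma21 b q g x = (1 / 2) * (nderiv ?S 1 g x + (- nderiv ?S 1 g 0)) + (- 1 / 2) * segint (\<lambda>s. q s * g s) x"
    if "x \<in> ?S" for x
  proof -
    have "gamma21 b q g x = (nderiv ?S 1 g x - nderiv ?S 1 g 0 - segint (\<lambda>s. q s * g s) x) / 2"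
      using gamma21_eq[OF assms(1) C_on_imp_continuous_on[OF assms(2)] C_on_imp_continuous_on[OF assms(3)]
        that C_on_Suc_has_vector_derivative[OF assms(3)]] .
    also have "\<dots> = (1 / 2) * (nderiv ?S 1 g x + (- nderiv ?S 1 g 0)) + (- 1 / 2) * segint (\<lambda>s. q s * g s) x"
      by (simp add: diff_divide_distrib)
    finally show ?thesis .
  qed
  ultimately show ?thesis by (subst C_on_cong) auto
qed

text \<open>Counting derivatives from \<open>T [1] = - \<integral> q \<in> C\<^bsup>p + 1\<^esup>\<close> on: the iterates can be formed until
  the last one is merely continuous.\<close>

lemma gamma21_exists_one:
  assumes "0 < b" "C_on p {- b..b} q" "j \<le> p + 2"
  shows "gamma21_exists b q j (\<lambda>_. 1) \<and> C_on (p + 2 - j) {- b..b} ((gamma21 b q ^^ j) (\<lambda>_. 1))"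
  using assms(3)
proof (induction j)
  case 0
  show ?case by (simp add: C_on_const[OF assms(1)])
next
  case (Suc j)
  have C: "C_on (Suc (p + 2 - Suc j)) {- b..b} ((gamma21 b q ^^ j) (\<lambda>_. 1))"
    using Suc by (subst Suc_diff_Suc) auto
  with C_on_le[OF C, of 1] C_on_gamma21[OF assms(1,2) C] Suc show ?case by simp
qed

section \<open>The Goursat kernel\<close>

lemma continuous_on_diamond_fst:
  "continuous_on {- b..b} g \<Longrightarrow> continuous_on (diamond b) (\<lambda>(u, v). g u)"
  unfolding case_prod_beta
  by (rule continuous_on_compose2[of _ g]) (auto simp: diamond_def intro!: continuous_intros)

lemma continuous_on_diamond_uminus_snd:
  "continuous_on {- b..b} g \<Longrightarrow> continuous_on (diamond b) (\<lambda>(u, v). g (- v))"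
  unfolding case_prod_beta
  by (rule continuous_on_compose2[of _ g]) (auto simp: diamond_def intro!: continuous_intros)

lemma continuous_on_diamond_sum:
  "continuous_on {- b..b} g \<Longrightarrow> continuous_on (diamond b) (\<lambda>(u, v). g (u + v))"
  unfolding case_prod_beta
  by (rule continuous_on_compose2[of _ g]) (auto simp: diamond_def intro!: continuous_intros)

lemma continuous_on_case_prod_add:
  "continuous_on S (\<lambda>(u, v). F u v) \<Longrightarrow> continuous_on S (\<lambda>(u, v). G u v) \<Longrightarrow>
   continuous_on S (\<lambda>(u, v). F u v + G u v :: complex)"
  by (simp add: case_prod_beta' continuous_on_add)

lemma continuous_on_case_prod_mult:
  "continuous_on S (\<lambda>(u, v). F u v) \<Longrightarrow> continuous_on S (\<lambda>(u, v). G u v) \<Longrightarrow>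
   continuous_on S (\<lambda>(u, v). F u v * G u v :: complex)"
  by (simp add: case_prod_beta' continuous_on_mult)

locale goursat =
  fixes b :: real and q :: "real \<Rightarrow> complex" and h :: complex and H :: "real \<Rightarrow> real \<Rightarrow> complex"
  assumes b_pos: "0 < b"
    and q_cont: "continuous_on {- b..b} q"
    and solution: "goursat_solution b q h H"
begin

abbreviation "qH u v \<equiv> q (u + v) * H u v"

lemma H_cont: "continuous_on (diamond b) (\<lambda>(u, v). H u v)"
  using solution by (simp add: goursat_solution_def diamond_def)

lemma qH_cont: "continuous_on (diamond b) (\<lambda>(u, v). qH u v)"
  by (intro continuous_on_case_prod_mult continuous_on_diamond_sum q_cont H_cont)

lemma H_fst_axis: "x \<in> {- b..b} \<Longrightarrow> H x 0 = h / 2 + segint q x / 2"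
  using solution LBINT_eq_segint[OF q_cont] by (simp add: goursat_solution_def)

lemma H_snd_axis: "x \<in> {- b..b} \<Longrightarrow> H 0 x = h / 2"
  using solution by (simp add: goursat_solution_def)

lemma slice_interval: "{v'. \<bar>u\<bar> + \<bar>v'\<bar> \<le> b} = {- (b - \<bar>u\<bar>)..b - \<bar>u\<bar>}" "{u'. \<bar>u'\<bar> + \<bar>v\<bar> \<le> b} = {- (b - \<bar>v\<bar>)..b - \<bar>v\<bar>}"
  by auto

text \<open>The equation \<open>H\<^sub>u\<^sub>v = q H\<close> is integrated from the axis \<open>u = 0\<close>, where \<open>H\<close> is constant and
  hence \<open>H\<^sub>v\<close> vanishes.\<close>

lemma H_deriv_snd:
  assumes "(u, v) \<in> diamond b"
  shows "(H u has_vector_derivative segint (\<lambda>\<alpha>. qH \<alpha> v) u) (at v within {- (b - \<bar>u\<bar>)..b - \<bar>u\<bar>})"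
proof -
  obtain Hv where Hv: "\<And>u v. (u, v) \<in> diamond b \<Longrightarrow>
        (H u has_vector_derivative Hv u v) (at v within {- (b - \<bar>u\<bar>)..b - \<bar>u\<bar>})"
    and Hvu: "\<And>u v. (u, v) \<in> diamond b \<Longrightarrow>
        ((\<lambda>u'. Hv u' v) has_vector_derivative qH u v) (at u within {- (b - \<bar>v\<bar>)..b - \<bar>v\<bar>})"
    using solution unfolding goursat_solution_def slice_interval diamond_def by auto
  \<comment> \<open>On the slice with fixed \<open>v\<close>; it degenerates to a point at the corners \<open>v = \<plusminus>b\<close>, where nothing is to be shown.\<close>
  have "Hv u v = Hv 0 v + segint (\<lambda>\<alpha>. qH \<alpha> v) u"
  proof (rule segint_derivative[where g = "\<lambda>u. Hv u v"])
    show "((\<lambda>u'. Hv u' v) has_vector_derivative qH u v) (at u within {- (b - \<bar>v\<bar>)..b - \<bar>v\<bar>})"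
      if "u \<in> {- (b - \<bar>v\<bar>)..b - \<bar>v\<bar>}" for u
      using that by (intro Hvu) (auto simp: diamond_def)
    show "continuous_on {- (b - \<bar>v\<bar>)..b - \<bar>v\<bar>} (\<lambda>\<alpha>. qH \<alpha> v)"
      by (intro continuous_on_diamond_compose[OF qH_cont] continuous_intros) (auto simp: diamond_def)
    show "u \<in> {- (b - \<bar>v\<bar>)..b - \<bar>v\<bar>}"
      using assms by (auto simp: diamond_def)
  qed
  moreover have "Hv 0 v = 0"
  proof (rule vector_derivative_unique_within_closed_interval[of "- b" b v "H 0"])
    show "- b < b" "v \<in> cbox (- b) b" using b_pos assms by (auto simp: diamond_def)
    then show "(H 0 has_vector_derivative Hv 0 v) (at v within cbox (- b) b)"
      using Hv[of 0 v] by (auto simp: diamond_def)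
    have "((\<lambda>_. h / 2) has_vector_derivative 0) (at v within cbox (- b) b)"
      by (auto intro!: derivative_eq_intros)
    then show "(H 0 has_vector_derivative 0) (at v within cbox (- b) b)"
      using \<open>v \<in> cbox (- b) b\<close>
      by (rule has_vector_derivative_transform[rotated 2]) (simp add: H_snd_axis)
  qed
  ultimately show ?thesis using Hv[OF assms] by simp
qed

text \<open>The Goursat data speak only of \<open>H\<^sub>v\<close>. Integrating once more gives the integral equation
  \<open>H (u, v) = H (u, 0) + \<integral>\<integral> q H\<close>; exchanging the integrals shows differentiability in \<open>u\<close>.\<close>

lemma H_deriv_fst:
  assumes uv: "(u, v) \<in> diamond b"
  shows "((\<lambda>u. H u v) has_vector_derivative q u / 2 + segint (qH u) v) (at u within {- (b - \<bar>v\<bar>)..b - \<bar>v\<bar>})"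
proof -
  define I where "I = {- (b - \<bar>v\<bar>)..b - \<bar>v\<bar>}"
  have I: "I \<subseteq> {- b..b}" "\<And>u. u \<in> I \<Longrightarrow> (u, v) \<in> diamond b" and u: "u \<in> I"
    using uv by (auto simp: I_def diamond_def)
  have H_eq: "H u v = (h / 2 + segint q u / 2) + segint (\<lambda>\<alpha>. segint (qH \<alpha>) v) u" if "u \<in> I" for u
  proof -
    have uv: "(u, v) \<in> diamond b" using that I by blast
    have "H u v = H u 0 + segint (\<lambda>\<beta>. segint (\<lambda>\<alpha>. qH \<alpha> \<beta>) u) v"
    proof (rule segint_derivative)
      show "(H u has_vector_derivative segint (\<lambda>\<alpha>. qH \<alpha> y) u) (at y within {- (b - \<bar>u\<bar>)..b - \<bar>u\<bar>})"
        if "y \<in> {- (b - \<bar>u\<bar>)..b - \<bar>u\<bar>}" for y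
        using that by (intro H_deriv_snd) (auto simp: diamond_def)
      show "continuous_on {- (b - \<bar>u\<bar>)..b - \<bar>u\<bar>} (\<lambda>\<beta>. segint (\<lambda>\<alpha>. qH \<alpha> \<beta>) u)"
        by (intro continuous_on_diamond_compose[OF continuous_on_segint_param'[OF qH_cont]] continuous_intros)
           (auto simp: diamond_def)
      show "v \<in> {- (b - \<bar>u\<bar>)..b - \<bar>u\<bar>}"
        using uv by (auto simp: diamond_def)
    qed
    then show ?thesis
      using segint_segint_swap[OF qH_cont uv] H_fst_axis[of u] that I by auto
  qed
  have "((\<lambda>u. (h / 2 + segint q u / 2) + segint (\<lambda>\<alpha>. segint (qH \<alpha>) v) u) has_vector_derivative
          (0 + q u / 2) + segint (qH u) v) (at u within I)"
  proof (intro has_vector_derivative_add has_vector_derivative_const has_vector_derivative_divide)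
    show "(segint q has_vector_derivative q u) (at u within I)"
      using segint_has_vector_derivative[OF q_cont, of u] u I
      by (blast intro: has_vector_derivative_within_subset)
    have "continuous_on I (\<lambda>\<alpha>. segint (qH \<alpha>) v)"
      by (intro continuous_on_diamond_compose[OF continuous_on_segint_param[OF qH_cont]] continuous_intros I)
    then show "(segint (\<lambda>\<alpha>. segint (qH \<alpha>) v) has_vector_derivative segint (qH u) v) (at u within I)"
      using u unfolding I_def by (rule segint_has_vector_derivative)
  qed
  then show ?thesis
    unfolding I_def[symmetric]
    using has_vector_derivative_transform[OF u H_eq] by simp
qed

text \<open>The two halves of the integral in \<open>G\<^sub>\<plusminus>\<close>: for \<open>x > 0\<close> the first involves \<open>\<eta>\<close> on
  \<open>[0, x]\<close> and the second \<open>\<eta>\<close> on \<open>[- x, 0]\<close>.\<close>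

definition same_side :: "(real \<Rightarrow> complex) \<Rightarrow> real \<Rightarrow> complex" where
  "same_side \<eta> = diagint (\<lambda>u v. H u v * \<eta> u)"

definition opposite_side :: "(real \<Rightarrow> complex) \<Rightarrow> real \<Rightarrow> complex" where
  "opposite_side \<eta> = diagint (\<lambda>u v. H u v * \<eta> (- v))"

lemma cont_H_fst: "continuous_on {- b..b} \<eta> \<Longrightarrow> continuous_on (diamond b) (\<lambda>(u, v). H u v * \<eta> u)"
  by (intro continuous_on_case_prod_mult H_cont continuous_on_diamond_fst)

lemma cont_H_snd: "continuous_on {- b..b} \<eta> \<Longrightarrow> continuous_on (diamond b) (\<lambda>(u, v). H u v * \<eta> (- v))"
  by (intro continuous_on_case_prod_mult H_cont continuous_on_diamond_uminus_snd)

lemma same_side_cont: "continuous_on {- b..b} \<eta> \<Longrightarrow> continuous_on {- b..b} (same_side \<eta>)"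
  unfolding same_side_def by (intro continuous_on_diagint cont_H_fst)

lemma opposite_side_cont: "continuous_on {- b..b} \<eta> \<Longrightarrow> continuous_on {- b..b} (opposite_side \<eta>)"
  unfolding opposite_side_def by (intro continuous_on_diagint cont_H_snd)

text \<open>Here \<open>\<eta>\<close> depends on \<open>u\<close>, so differentiating in \<open>u\<close> produces \<open>\<eta>'\<close> with the same kernel; the part
  \<open>\<integral>\<^sub>0\<^sup>v q H\<close> of \<open>H\<^sub>u\<close> is absorbed by Fubini into \<open>\<integral>\<^sub>0\<^sup>x q\<close> times the operator
  itself, and the part \<open>q / 2\<close> contributes \<open>\<integral> q \<eta> / 2\<close>.\<close>

lemma same_side_deriv:
  assumes deriv: "\<And>x. x \<in> {- b..b} \<Longrightarrow> (\<eta> has_vector_derivative \<eta>' x) (at x within {- b..b})"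
    and cont': "continuous_on {- b..b} \<eta>'" and x: "x \<in> {- b..b}"
  shows "(same_side \<eta> has_vector_derivative h / 2 * \<eta> 0 + (segint (\<lambda>s. q s * \<eta> s) x / 2
            + segint (\<lambda>s. q s * same_side \<eta> s) x + same_side \<eta>' x)) (at x within {- b..b})"
proof -
  have cont: "continuous_on {- b..b} \<eta>"
    using deriv continuous_on_vector_derivative by blast
  have cont_q: "continuous_on (diamond b) (\<lambda>(u, v). 1 / 2 * (q u * \<eta> u))"
    by (intro continuous_on_diamond_fst continuous_intros cont q_cont)
  have cont_W: "continuous_on (diamond b) (\<lambda>(u, v). qH u v * \<eta> u)"
    by (intro continuous_on_case_prod_mult qH_cont continuous_on_diamond_fst cont)
  note cont_IW = continuous_on_segint_param[OF cont_W]
  let ?N' = "\<lambda>u v. (1 / 2 * (q u * \<eta> u) + segint (\<lambda>\<beta>. qH u \<beta> * \<eta> u) v) + H u v * \<eta>' u"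
  have "(same_side \<eta> has_vector_derivative H 0 x * \<eta> 0 + diagint ?N' x) (at x within {- b..b})"
    unfolding same_side_def
  proof (rule diagint_has_vector_derivative_fst[OF cont_H_fst[OF cont] _ _ x])
    show "continuous_on (diamond b) (\<lambda>(u, v). ?N' u v)"
      by (intro continuous_on_case_prod_add cont_q cont_IW cont_H_fst cont')
    fix u v assume uv: "(u, v) \<in> diamond b"
    let ?I = "{- (b - \<bar>v\<bar>)..b - \<bar>v\<bar>}"
    have "?I \<subseteq> {- b..b}" "u \<in> {- b..b}" using uv by (auto simp: diamond_def)
    then have "(\<eta> has_vector_derivative \<eta>' u) (at u within ?I)"
      using deriv has_vector_derivative_within_subset by blast
    from has_vector_derivative_mult[OF H_deriv_fst[OF uv] this]
    show "((\<lambda>u. H u v * \<eta> u) has_vector_derivative ?N' u v) (at u within ?I)"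
      using segint_mult_left[of "\<eta> u" "qH u" v] by (simp add: algebra_simps)
  qed
  also have "diagint ?N' x = segint (\<lambda>s. q s * \<eta> s) x / 2 + segint (\<lambda>s. q s * same_side \<eta> s) x + same_side \<eta>' x"
  proof -
    have "diagint ?N' x = diagint (\<lambda>u v. 1 / 2 * (q u * \<eta> u)) x
       + diagint (\<lambda>u v. segint (\<lambda>\<beta>. qH u \<beta> * \<eta> u) v) x + diagint (\<lambda>u v. H u v * \<eta>' u) x"
      by (simp only: diagint_add[OF continuous_on_case_prod_add[OF cont_q cont_IW] cont_H_fst[OF cont'] x]
          diagint_add[OF cont_q cont_IW x])
    moreover have "diagint (\<lambda>u v. 1 / 2 * (q u * \<eta> u)) x = segint (\<lambda>s. q s * \<eta> s) x / 2"
      by (simp only: diagint_mult_left diagint_only_first) simp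
    moreover have "diagint (\<lambda>u v. segint (\<lambda>\<beta>. qH u \<beta> * \<eta> u) v) x = segint (\<lambda>s. q s * same_side \<eta> s) x"
      using segint_diagint[OF cont_W x] unfolding same_side_def mult.assoc
        diagint_mult_sum_arg[of q "\<lambda>u v. H u v * \<eta> u"] by (rule sym)
    ultimately show ?thesis by (simp add: same_side_def)
  qed
  finally show ?thesis using H_snd_axis[OF x] by simp
qed

text \<open>The mirror image, differentiating in \<open>v\<close>. The sign in front of \<open>\<eta>'\<close> comes from \<open>\<eta> (- v)\<close>; it
  is the reason why differentiation interchanges \<open>G\<^sub>+\<close> and \<open>G\<^sub>-\<close>.\<close>

lemma opposite_side_deriv:
  assumes deriv: "\<And>x. x \<in> {- b..b} \<Longrightarrow> (\<eta> has_vector_derivative \<eta>' x) (at x within {- b..b})"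
    and cont': "continuous_on {- b..b} \<eta>'" and x: "x \<in> {- b..b}"
  shows "(opposite_side \<eta> has_vector_derivative (h / 2 + segint q x / 2) * \<eta> 0
            + (segint (\<lambda>s. q s * opposite_side \<eta> s) x - opposite_side \<eta>' x)) (at x within {- b..b})"
proof -
  have cont: "continuous_on {- b..b} \<eta>"
    using deriv continuous_on_vector_derivative by blast
  have cont_W: "continuous_on (diamond b) (\<lambda>(u, v). qH u v * \<eta> (- v))"
    by (intro continuous_on_case_prod_mult qH_cont continuous_on_diamond_uminus_snd cont)
  note cont_IW = continuous_on_segint_param'[OF cont_W]
  have cont_H': "continuous_on (diamond b) (\<lambda>(u, v). (- 1) * (H u v * \<eta>' (- v)))"
    using continuous_on_case_prod_mult[OF _ cont_H_snd[OF cont'], of "\<lambda>_ _. - 1"] by simp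
  let ?N' = "\<lambda>u v. segint (\<lambda>\<alpha>. qH \<alpha> v * \<eta> (- v)) u + (- 1) * (H u v * \<eta>' (- v))"
  have "(opposite_side \<eta> has_vector_derivative H x 0 * \<eta> (- 0) + diagint ?N' x) (at x within {- b..b})"
    unfolding opposite_side_def
  proof (rule diagint_has_vector_derivative_snd[OF cont_H_snd[OF cont] _ _ x])
    show "continuous_on (diamond b) (\<lambda>(u, v). ?N' u v)"
      by (intro continuous_on_case_prod_add cont_IW cont_H')
    fix u v assume uv: "(u, v) \<in> diamond b"
    let ?I = "{- (b - \<bar>u\<bar>)..b - \<bar>u\<bar>}"
    have "uminus ` ?I \<subseteq> {- b..b}" "- v \<in> {- b..b}" using uv by (auto simp: diamond_def)
    then have "(\<eta> has_vector_derivative \<eta>' (- v)) (at (- v) within uminus ` ?I)"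
      using deriv has_vector_derivative_within_subset by blast
    moreover have "(uminus has_vector_derivative (- 1 :: real)) (at v within ?I)"
      by (auto intro!: derivative_eq_intros)
    ultimately have "((\<lambda>v. \<eta> (- v)) has_vector_derivative - \<eta>' (- v)) (at v within ?I)"
      using vector_diff_chain_within[of uminus "-1" v ?I \<eta> "\<eta>' (- v)"] by (simp add: o_def)
    from has_vector_derivative_mult[OF H_deriv_snd[OF uv] this]
    show "((\<lambda>v. H u v * \<eta> (- v)) has_vector_derivative ?N' u v) (at v within ?I)"
      using segint_mult_left[of "\<eta> (- v)" "\<lambda>\<alpha>. qH \<alpha> v" u] by (simp add: algebra_simps)
  qed
  also have "diagint ?N' x = segint (\<lambda>s. q s * opposite_side \<eta> s) x - opposite_side \<eta>' x"
  proof -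
    have "diagint ?N' x = diagint (\<lambda>u v. segint (\<lambda>\<alpha>. qH \<alpha> v * \<eta> (- v)) u) x
       + (- 1) * diagint (\<lambda>u v. H u v * \<eta>' (- v)) x"
      by (simp only: diagint_add[OF cont_IW cont_H' x] diagint_mult_left)
    moreover have "diagint (\<lambda>u v. segint (\<lambda>\<alpha>. qH \<alpha> v * \<eta> (- v)) u) x = segint (\<lambda>s. q s * opposite_side \<eta> s) x"
      using segint_diagint'[OF cont_W x] unfolding opposite_side_def mult.assoc
        diagint_mult_sum_arg[of q "\<lambda>u v. H u v * \<eta> (- v)"] by (rule sym)
    ultimately show ?thesis by (simp add: opposite_side_def)
  qed
  finally show ?thesis using H_fst_axis[OF x] by simp
qed

text \<open>The substitution \<open>t = - x + 2 r x\<close>, which sends the arguments of the kernel to the point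
  \<open>(r x, (1 - r) x)\<close> of the diagonal.\<close>

lemma kernel_integral:
  assumes cont: "continuous_on {- b..b} \<eta>" and x: "x \<in> {- b..b}"
  shows "(LBINT t=- x..x. kernel_of H x t * (\<eta> ((t + x) / 2) + c * \<eta> ((t - x) / 2))) = 2 * (same_side \<eta> x + c * opposite_side \<eta> x)"
proof -
  let ?M = "\<lambda>u v. H u v * \<eta> u + c * (H u v * \<eta> (- v))"
  have cont_M: "continuous_on (diamond b) (\<lambda>(u, v). c * (H u v * \<eta> (- v)))"
    using continuous_on_case_prod_mult[OF _ cont_H_snd[OF cont], of "\<lambda>_ _. c"] by simp
  let ?g = "\<lambda>t. kernel_of H x t * (\<eta> ((t + x) / 2) + c * \<eta> ((t - x) / 2))"
  have g: "?g t = ?M ((x + t) / 2) ((x - t) / 2)" for t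
  proof -
    \<comment> \<open>The argument \<open>(t - x) / 2\<close> of \<open>\<eta>\<close> is minus the second characteristic coordinate.\<close>
    have "(t - x) / 2 = - ((x - t) / 2)" "t + x = x + t" by (simp_all add: field_simps)
    then show ?thesis by (simp only: kernel_of_def distrib_left mult.left_commute)
  qed
  have args: "(x + (- x + r * (2 * x))) / 2 = r * x" "(x - (- x + r * (2 * x))) / 2 = (1 - r) * x" for r
    by (simp_all add: field_simps)
  have "continuous_on ((\<lambda>r. - x + r * (2 * x)) ` {0..1}) ?g"
    unfolding g
    by (intro continuous_on_diamond_compose[OF continuous_on_case_prod_add[OF cont_H_fst[OF cont] cont_M]] continuous_intros)
       (use diagonal_in_diamond[OF x] in \<open>auto simp only: args image_iff\<close>)
  from LBINT_affine[OF this]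
  have "(LBINT t=- x..x. ?g t) = of_real (2 * x) * integral {0..1} (\<lambda>r. ?M (r * x) ((1 - r) * x))"
    unfolding g args by simp
  also have "\<dots> = 2 * diagint ?M x"
    by (simp add: diagint_def)
  finally show ?thesis
    by (simp add: diagint_add[OF cont_H_fst[OF cont] cont_M x] diagint_mult_left same_side_def opposite_side_def)
qed

lemma G_plus_eq:
  assumes "continuous_on {- b..b} \<eta>" "x \<in> {- b..b}"
  shows "G_plus (kernel_of H) \<eta> x = \<eta> x + 2 * (same_side \<eta> x + opposite_side \<eta> x)"
  using kernel_integral[OF assms, of 1] by (simp add: G_plus_def)

lemma G_minus_eq:
  assumes "continuous_on {- b..b} \<eta>" "x \<in> {- b..b}"
  shows "G_minus (kernel_of H) \<eta> x = \<eta> x + 2 * (same_side \<eta> x - opposite_side \<eta> x)"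
  using kernel_integral[OF assms, of "- 1"] by (simp add: G_minus_def)

lemma G_plus_cont: "continuous_on {- b..b} \<eta> \<Longrightarrow> continuous_on {- b..b} (G_plus (kernel_of H) \<eta>)"
  by (subst continuous_on_cong[OF refl G_plus_eq]) (auto intro!: continuous_intros same_side_cont opposite_side_cont)

lemma G_minus_cont: "continuous_on {- b..b} \<eta> \<Longrightarrow> continuous_on {- b..b} (G_minus (kernel_of H) \<eta>)"
  by (subst continuous_on_cong[OF refl G_minus_eq]) (auto intro!: continuous_intros same_side_cont opposite_side_cont)

lemma segint_q_lincomb:
  assumes "continuous_on {- b..b} \<eta>" "x \<in> {- b..b}"
  shows "segint (\<lambda>s. q s * (\<eta> s + 2 * (same_side \<eta> s + c * opposite_side \<eta> s))) x =
    segint (\<lambda>s. q s * \<eta> s) x + 2 * segint (\<lambda>s. q s * same_side \<eta> s) x + 2 * c * segint (\<lambda>s. q s * opposite_side \<eta> s) x"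
proof -
  have "segint (\<lambda>s. q s * (\<eta> s + 2 * (same_side \<eta> s + c * opposite_side \<eta> s))) x =
    segint (\<lambda>s. q s * \<eta> s + (2 * (q s * same_side \<eta> s) + (2 * c) * (q s * opposite_side \<eta> s))) x"
    by (simp add: algebra_simps)
  also have "\<dots> = segint (\<lambda>s. q s * \<eta> s) x
      + (2 * segint (\<lambda>s. q s * same_side \<eta> s) x + (2 * c) * segint (\<lambda>s. q s * opposite_side \<eta> s) x)"
    using segint_add[OF _ _ assms(2)] assms q_cont same_side_cont opposite_side_cont
    by (simp add: segint_add[where c = b] segint_mult_left continuous_on_add continuous_on_mult)
  finally show ?thesis by simp
qed

text \<open>Besides \<open>G\<^sub>- \<eta>'\<close> and \<open>\<integral> q G\<^sub>+ \<eta>\<close> only boundary terms remain, from the values of \<open>H\<close> on the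
  two axes. In \<open>G\<^sub>+\<close> these values add up to \<open>h + \<integral> q / 2\<close>, in \<open>G\<^sub>-\<close> their difference
  \<open>- \<integral> q / 2\<close> is left.\<close>

lemma G_plus_deriv:
  assumes deriv: "\<And>x. x \<in> {- b..b} \<Longrightarrow> (\<eta> has_vector_derivative \<eta>' x) (at x within {- b..b})"
    and cont': "continuous_on {- b..b} \<eta>'" and x: "x \<in> {- b..b}"
  shows "(G_plus (kernel_of H) \<eta> has_vector_derivative
     G_minus (kernel_of H) \<eta>' x + \<eta> 0 * (2 * h + segint q x)
       + segint (\<lambda>s. q s * G_plus (kernel_of H) \<eta> s) x) (at x within {- b..b})"
proof -
  have cont: "continuous_on {- b..b} \<eta>"
    using deriv continuous_on_vector_derivative by blast
  have "segint (\<lambda>s. q s * G_plus (kernel_of H) \<eta> s) x = segint (\<lambda>s. q s * (\<eta> s + 2 * (same_side \<eta> s + 1 * opposite_side \<eta> s))) x"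
    using x G_plus_eq[OF cont] by (intro segint_cong) auto
  note 1 = this[unfolded segint_q_lincomb[OF cont x]]
  have "((\<lambda>x. \<eta> x + 2 * (same_side \<eta> x + opposite_side \<eta> x)) has_vector_derivative
     \<eta>' x + 2 * ((h / 2 * \<eta> 0 + (segint (\<lambda>s. q s * \<eta> s) x / 2 + segint (\<lambda>s. q s * same_side \<eta> s) x + same_side \<eta>' x))
       + ((h / 2 + segint q x / 2) * \<eta> 0 + (segint (\<lambda>s. q s * opposite_side \<eta> s) x - opposite_side \<eta>' x)))) (at x within {- b..b})"
    by (intro has_vector_derivative_add has_vector_derivative_mult_right deriv same_side_deriv opposite_side_deriv cont' x)
  from has_vector_derivative_transform[OF x G_plus_eq[OF cont] this]
  show ?thesis
    unfolding 1 G_minus_eq[OF cont' x] by (simp add: algebra_simps)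
qed

lemma G_minus_deriv:
  assumes deriv: "\<And>x. x \<in> {- b..b} \<Longrightarrow> (\<eta> has_vector_derivative \<eta>' x) (at x within {- b..b})"
    and cont': "continuous_on {- b..b} \<eta>'" and x: "x \<in> {- b..b}"
  shows "(G_minus (kernel_of H) \<eta> has_vector_derivative
     G_plus (kernel_of H) \<eta>' x - \<eta> 0 * segint q x
       + segint (\<lambda>s. q s * G_minus (kernel_of H) \<eta> s) x) (at x within {- b..b})"
proof -
  have cont: "continuous_on {- b..b} \<eta>"
    using deriv continuous_on_vector_derivative by blast
  have "segint (\<lambda>s. q s * G_minus (kernel_of H) \<eta> s) x = segint (\<lambda>s. q s * (\<eta> s + 2 * (same_side \<eta> s + (- 1) * opposite_side \<eta> s))) x"
    using x G_minus_eq[OF cont] by (intro segint_cong) auto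
  note 1 = this[unfolded segint_q_lincomb[OF cont x]]
  have "((\<lambda>x. \<eta> x + 2 * (same_side \<eta> x - opposite_side \<eta> x)) has_vector_derivative
     \<eta>' x + 2 * ((h / 2 * \<eta> 0 + (segint (\<lambda>s. q s * \<eta> s) x / 2 + segint (\<lambda>s. q s * same_side \<eta> s) x + same_side \<eta>' x))
       - ((h / 2 + segint q x / 2) * \<eta> 0 + (segint (\<lambda>s. q s * opposite_side \<eta> s) x - opposite_side \<eta>' x)))) (at x within {- b..b})"
    by (intro has_vector_derivative_add has_vector_derivative_diff has_vector_derivative_mult_right
        deriv same_side_deriv opposite_side_deriv cont' x)
  from has_vector_derivative_transform[OF x G_minus_eq[OF cont] this]
  show ?thesis
    unfolding 1 G_plus_eq[OF cont' x] by (simp add: algebra_simps)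
qed

end

section \<open>One step and the iterates\<close>

text \<open>The Wronskian of \<open>w\<close> and \<open>f\<close> is constant and vanishes at the origin, so \<open>w / f\<close> is constant. Dividing
  by the nowhere vanishing solution \<open>f\<close> avoids a Gronwall argument.\<close>

lemma linear_ode_unique:
  fixes q f f' w w' :: "real \<Rightarrow> complex"
  assumes "x \<in> {- b..b}"
    and f: "\<And>x. x \<in> {- b..b} \<Longrightarrow> (f has_vector_derivative f' x) (at x within {- b..b})"
    and f': "\<And>x. x \<in> {- b..b} \<Longrightarrow> (f' has_vector_derivative q x * f x) (at x within {- b..b})"
    and nz: "\<And>x. x \<in> {- b..b} \<Longrightarrow> f x \<noteq> 0"
    and w: "\<And>x. x \<in> {- b..b} \<Longrightarrow> (w has_vector_derivative w' x) (at x within {- b..b})"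
    and w': "\<And>x. x \<in> {- b..b} \<Longrightarrow> (w' has_vector_derivative q x * w x) (at x within {- b..b})"
    and init: "w 0 = f 0" "w' 0 = f' 0"
  shows "w x = f x"
proof -
  have "((\<lambda>x. w' x * f x - w x * f' x) has_vector_derivative 0) (at x within {- b..b})"
    if "x \<in> {- b..b}" for x
    using has_vector_derivative_diff[OF
      has_vector_derivative_mult[OF w'[OF that] f[OF that]]
      has_vector_derivative_mult[OF w[OF that] f'[OF that]]] by (simp add: algebra_simps)
  then obtain c where c: "\<And>x. x \<in> {- b..b} \<Longrightarrow> w' x * f x - w x * f' x = c"
    using has_vector_derivative_zero_constant[of "{- b..b}" "\<lambda>x. w' x * f x - w x * f' x"] by auto
  have zero: "0 \<in> {- b..b}" using assms(1) by auto
  have wronskian: "w' x * f x = w x * f' x" if "x \<in> {- b..b}" for x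
    using c[OF that] c[OF zero] init by simp
  have "((\<lambda>x. w x / f x) has_vector_derivative 0) (at x within {- b..b})" if "x \<in> {- b..b}" for x
  proof -
    have "((\<lambda>x. inverse (f x)) has_vector_derivative - (f' x / (f x)\<^sup>2)) (at x within {- b..b})"
      using field_vector_diff_chain_within[OF f[OF that]
          has_field_derivative_at_within[OF DERIV_inverse[OF nz[OF that]]]]
      by (simp add: o_def divide_inverse power_inverse numeral_2_eq_2)
    from has_vector_derivative_mult[OF w[OF that] this]
    show ?thesis using wronskian[OF that] nz[OF that] by (simp add: field_simps power2_eq_square)
  qed
  then obtain d where d: "\<And>x. x \<in> {- b..b} \<Longrightarrow> w x / f x = d"
    using has_vector_derivative_zero_constant[of "{- b..b}" "\<lambda>x. w x / f x"] by auto
  then show ?thesis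
    using d[OF assms(1)] d[OF zero] init nz[OF zero] nz[OF assms(1)] by (simp add: field_simps)
qed

lemma two_gamma21_pow_0 [simp]: "two_gamma21_pow b q 0 g x = g x"
  by (simp add: two_gamma21_pow_def)

lemma two_gamma21_pow_add:
  assumes "0 < b" "continuous_on {- b..b} q" "gamma21_exists b q n g" "gamma21_exists b q n h"
  shows "gamma21_exists b q n (\<lambda>x. g x + c * h x)"
    and "x \<in> {- b..b} \<Longrightarrow> two_gamma21_pow b q n (\<lambda>x. g x + c * h x) x =
        two_gamma21_pow b q n g x + c * two_gamma21_pow b q n h x"
  using gamma21_pow_lincomb[OF assms, of 1 c] by (auto simp: two_gamma21_pow_def algebra_simps)

text \<open>An iterate peeled off at the inner end, where the one-step identities apply.\<close>

lemma two_gamma21_pow_Suc: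
  assumes "0 < b" "continuous_on {- b..b} q" "C_on 1 {- b..b} g"
    and step: "\<forall>x\<in>{- b..b}. 2 * gamma21 b q g x = g' x"
    and g': "gamma21_exists b q n g'"
  shows "gamma21_exists b q (Suc n) g"
    and "x \<in> {- b..b} \<Longrightarrow> two_gamma21_pow b q (Suc n) g x = two_gamma21_pow b q n g' x"
proof -
  \<comment> \<open>Halving is written as a linear combination to reuse linearity of the iterates.\<close>
  have eq: "gamma21 b q g x = 1 / 2 * g' x + 0 * g' x" if "x \<in> {- b..b}" for x
    using arg_cong[OF step[THEN bspec, OF that], of "\<lambda>z. z / 2"] by simp
  note lin = gamma21_pow_lincomb[OF assms(1,2) g' g', of "1 / 2" 0]
  show "gamma21_exists b q (Suc n) g"
    using lin gamma21_exists_cong[OF assms(1) eq, where q = q and n = n] assms(3) by (simp add: gamma21_exists_Suc_iff del: gamma21_exists.simps)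
  show "two_gamma21_pow b q (Suc n) g x = two_gamma21_pow b q n g' x" if "x \<in> {- b..b}"
  proof -
    have "(gamma21 b q ^^ n) (gamma21 b q g) x = (gamma21 b q ^^ n) (\<lambda>x. 1 / 2 * g' x + 0 * g' x) x"
      using assms(1) eq that by (rule gamma21_pow_cong)
    also have "\<dots> = 1 / 2 * (gamma21 b q ^^ n) g' x + 0 * (gamma21 b q ^^ n) g' x"
      using lin that by blast
    finally have "2 * (gamma21 b q ^^ n) (gamma21 b q g) x = (gamma21 b q ^^ n) g' x"
      by (simp add: mult.commute)
    then show ?thesis
      by (simp add: two_gamma21_pow_def funpow_Suc_right del: funpow.simps)
  qed
qed

lemma two_gamma21_pow_zero:
  assumes "0 < b" "\<And>x. x \<in> {- b..b} \<Longrightarrow> g x = 0"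
  shows "gamma21_exists b q n g"
    and "x \<in> {- b..b} \<Longrightarrow> two_gamma21_pow b q n g x = 0"
proof -
  have D: "nderiv {- b..b} 1 (\<lambda>_. 0) y = 0" if "y \<in> {- b..b}" for y
    by (rule nderiv_1_eqI[OF assms(1) that]) (auto intro!: derivative_eq_intros)
  have G: "gamma21 b q (\<lambda>_. 0) y = 0" if "y \<in> {- b..b}" for y
    using D[OF that] D[of 0] assms(1) by (simp add: gamma21_def)
  have zero: "(gamma21 b q ^^ n) (\<lambda>_. 0) y = 0" if "y \<in> {- b..b}" for n y
    using that
  proof (induction n arbitrary: y)
    case (Suc n)
    then show ?case
      using gamma21_cong[OF assms(1) Suc.IH, where q = q] G by simp
  qed simp
  have "gamma21_exists b q n (\<lambda>_. 0)"
  proof (induction n)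
    case (Suc n)
    have "C_on 1 {- b..b} ((gamma21 b q ^^ n) (\<lambda>_. 0))"
      using C_on_const[OF assms(1), of 1 0] by (rule C_on_cong[THEN iffD1, rotated]) (simp add: zero)
    with Suc show ?case by simp
  qed simp
  then show "gamma21_exists b q n g"
    using gamma21_exists_cong[OF assms, where q = q and n = n] by simp
  show "two_gamma21_pow b q n g x = 0" if "x \<in> {- b..b}"
    using gamma21_pow_cong[OF assms that, where q = q and n = n] zero[OF that] by (simp add: two_gamma21_pow_def)
qed

locale transmutation = goursat b q "f' 0" H
  for b :: real and q f f' :: "real \<Rightarrow> complex" and H +
  assumes f_deriv: "\<And>x. x \<in> {- b..b} \<Longrightarrow> (f has_vector_derivative f' x) (at x within {- b..b})"
    and f_ode: "\<And>x. x \<in> {- b..b} \<Longrightarrow> (f' has_vector_derivative q x * f x) (at x within {- b..b})"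
    and f_nonzero: "\<And>x. x \<in> {- b..b} \<Longrightarrow> f x \<noteq> 0"
    and f_zero: "f 0 = 1"
begin

abbreviation "K \<equiv> kernel_of H"
abbreviation "S \<equiv> {- b..b}"
abbreviation "D \<equiv> nderiv S 1"
abbreviation "T \<equiv> two_gamma21_pow b q"

lemma G_plus_0: "G_plus k \<eta> 0 = \<eta> 0" and G_minus_0: "G_minus k \<eta> 0 = \<eta> 0"
  by (simp_all add: G_plus_def G_minus_def zero_ereal_def[symmetric])

text \<open>The function \<open>w = (G\<^sub>+ [1] + 1) / 2\<close> satisfies \<open>w' = f' (0) + \<integral> q w\<close> and \<open>w (0) = 1\<close>.\<close>

lemma G_plus_one:
  assumes x: "x \<in> S"
  shows "G_plus K (\<lambda>_. 1) x = 2 * f x - 1"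
proof -
  let ?g = "G_plus K (\<lambda>_. 1)"
  define w where "w x = (?g x + 1) / 2" for x
  define w' where "w' x = f' 0 + segint (\<lambda>s. q s * w s) x" for x
  have g_cont: "continuous_on S ?g"
    by (intro G_plus_cont continuous_intros)
  have w_cont: "continuous_on S w"
    unfolding w_def by (intro continuous_intros g_cont) auto
  have g0: "G_minus K (\<lambda>_. 0) y = 0" for y
    by (simp add: G_minus_def)
  have g': "(?g has_vector_derivative (2 * f' 0 + segint q y) + segint (\<lambda>s. q s * ?g s) y) (at y within S)"
    if "y \<in> S" for y
    using G_plus_deriv[of "\<lambda>_. 1" "\<lambda>_. 0" y] that g0 by simp
  have "w x = f x"
  proof (rule linear_ode_unique[OF x f_deriv f_ode f_nonzero])
    fix y assume y: "y \<in> S"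
    have "segint (\<lambda>s. q s * w s) y = segint (\<lambda>s. 1 / 2 * (q s * ?g s) + 1 / 2 * q s) y"
      by (simp add: w_def field_simps)
    also have "\<dots> = 1 / 2 * segint (\<lambda>s. q s * ?g s) y + 1 / 2 * segint q y"
      by (subst segint_add[OF _ _ y], (intro continuous_intros q_cont g_cont)+) (simp only: segint_mult_left)
    finally have w': "w' y = ((2 * f' 0 + segint q y) + segint (\<lambda>s. q s * ?g s) y + 0) / 2"
      by (simp add: w'_def field_simps)
    show "(w has_vector_derivative w' y) (at y within S)"
      unfolding w' w_def
      by (intro has_vector_derivative_divide has_vector_derivative_add has_vector_derivative_const g' y)
    have "(w' has_vector_derivative 0 + q y * w y) (at y within S)"
      unfolding w'_def
      by (intro has_vector_derivative_add has_vector_derivative_const segint_has_vector_derivative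
          continuous_intros q_cont w_cont y)
    then show "(w' has_vector_derivative q y * w y) (at y within S)" by simp
  qed (simp_all add: w_def w'_def f_zero G_plus_0)
  then show ?thesis by (simp add: w_def field_simps)
qed

lemma G1_eq:
  assumes "continuous_on S \<eta>" "x \<in> S"
  shows "G1 K \<eta> x = G_plus K \<eta> x + \<eta> 0 * (1 - f x)"
proof -
  have "G_plus K (\<lambda>y. \<eta> y - \<eta> 0 / 2) x = G_plus K \<eta> x - \<eta> 0 / 2 * G_plus K (\<lambda>_. 1) x"
  proof -
    let ?c = "- (\<eta> 0 / 2)"
    have H1: "continuous_on (diamond b) (\<lambda>(u, v). H u v * 1)" by (simp add: H_cont)
    have Hc: "continuous_on (diamond b) (\<lambda>(u, v). ?c * (H u v * 1))"
      using continuous_on_case_prod_mult[OF _ H1, of "\<lambda>_ _. ?c"] by simp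
    have Lc: "same_side (\<lambda>y. \<eta> y - \<eta> 0 / 2) x = same_side \<eta> x + ?c * same_side (\<lambda>_. 1) x"
      using diagint_add[OF cont_H_fst[OF assms(1)] Hc assms(2)] unfolding same_side_def diagint_mult_left
      by (simp add: algebra_simps)
    have Rc: "opposite_side (\<lambda>y. \<eta> y - \<eta> 0 / 2) x = opposite_side \<eta> x + ?c * opposite_side (\<lambda>_. 1) x"
      using diagint_add[OF cont_H_snd[OF assms(1)] Hc assms(2)] unfolding opposite_side_def diagint_mult_left
      by (simp add: algebra_simps)
    have "continuous_on S (\<lambda>y. \<eta> y - \<eta> 0 / 2)"
      by (intro continuous_intros assms)
    then show ?thesis
      unfolding G_plus_eq[OF assms] G_plus_eq[OF continuous_on_const assms(2)]
      using assms(2) by (simp add: G_plus_eq Lc Rc algebra_simps)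
  qed
  then show ?thesis
    by (simp add: G1_def G_plus_one[OF assms(2)] field_simps)
qed

lemma f_cont: "continuous_on S f"
  using f_deriv continuous_on_vector_derivative by blast

text \<open>The correction by \<open>\<eta> (0) / 2\<close> in the definition of \<open>G\<^sub>1\<close> is made so that the boundary term
  \<open>(\<eta> (0) / 2) \<integral> q\<close> of \<open>G\<^sub>+\<close> cancels against \<open>T [\<eta> (0) / 2]\<close>.\<close>

lemma G1_step:
  assumes "C_on 1 S \<eta>"
  shows "C_on 1 S (G1 K \<eta>)"
    and "x \<in> S \<Longrightarrow> 2 * gamma21 b q (G1 K \<eta>) x = G2 K (D \<eta>) x - D \<eta> 0"
proof -
  let ?\<eta> = "\<lambda>y. \<eta> y - \<eta> 0 / 2"
  have D: "(\<eta> has_vector_derivative D \<eta> y) (at y within S)" if "y \<in> S" for y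
    using C_on_Suc_has_vector_derivative[of 0 S \<eta> y] assms that by simp
  have cont: "continuous_on S \<eta>" and cont': "continuous_on S (D \<eta>)"
    using assms C_on_imp_continuous_on[OF assms] C_on_Suc[of 0 S \<eta>] by (auto simp: C_on_0)
  have D': "(?\<eta> has_vector_derivative D \<eta> y) (at y within S)" if "y \<in> S" for y
    using has_vector_derivative_diff[OF D[OF that] has_vector_derivative_const[of "\<eta> 0 / 2"]] by simp
  let ?g = "G_plus K ?\<eta>"
  define d where "d y = G_minus K (D \<eta>) y + ?\<eta> 0 * (2 * f' 0 + segint q y) + segint (\<lambda>s. q s * ?g s) y" for y
  have g_cont: "continuous_on S ?g"
    by (intro G_plus_cont continuous_intros cont)
  have G1: "G1 K \<eta> = (\<lambda>x. ?g x + \<eta> 0 / 2)"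
    by (simp add: G1_def fun_eq_iff)
  have deriv: "(G1 K \<eta> has_vector_derivative d y) (at y within S)" if "y \<in> S" for y
    using has_vector_derivative_add[OF G_plus_deriv[OF D' cont' that] has_vector_derivative_const[of "\<eta> 0 / 2"]]
    unfolding G1 d_def by simp
  have d_cont: "continuous_on S d"
    unfolding d_def
    by (intro continuous_intros G_minus_cont cont' continuous_on_segint q_cont g_cont)
  show "C_on 1 S (G1 K \<eta>)"
    using C_on_SucI[OF b_pos deriv, of 0] d_cont by (simp add: C_on_0)
  assume x: "x \<in> S"
  have "segint (\<lambda>s. q s * G1 K \<eta> s) x = segint (\<lambda>s. q s * ?g s + \<eta> 0 / 2 * q s) x"
    unfolding G1 by (simp add: algebra_simps)
  also have "\<dots> = segint (\<lambda>s. q s * ?g s) x + \<eta> 0 / 2 * segint q x"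
    by (subst segint_add[OF _ _ x], (intro continuous_intros q_cont g_cont)+) (simp only: segint_mult_left)
  finally have I: "segint (\<lambda>s. q s * G1 K \<eta> s) x = \<dots>" .
  have d0: "d 0 = D \<eta> 0 + \<eta> 0 / 2 * (2 * f' 0)"
    unfolding d_def G_minus_0 by simp
  have "continuous_on S (G1 K \<eta>)"
    unfolding G1 by (intro continuous_intros g_cont)
  then have "2 * gamma21 b q (G1 K \<eta>) x = d x - d 0 - segint (\<lambda>s. q s * G1 K \<eta> s) x"
    by (subst gamma21_eq[OF b_pos q_cont _ x deriv]) simp_all
  also have "\<dots> = G2 K (D \<eta>) x - D \<eta> 0"
    unfolding I d0 unfolding d_def G2_def by (simp add: algebra_simps)
  finally show "2 * gamma21 b q (G1 K \<eta>) x = G2 K (D \<eta>) x - D \<eta> 0" .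
qed

text \<open>Here the boundary term \<open>- \<eta> (0) \<integral> q\<close> cancels against \<open>T [- \<eta> (0)]\<close>, and passing from
  \<open>G\<^sub>+ \<eta>'\<close> to \<open>G\<^sub>1 \<eta>'\<close> brings in \<open>f\<close>.\<close>

lemma G2_step:
  assumes "C_on 1 S \<eta>"
  shows "C_on 1 S (\<lambda>x. G2 K \<eta> x - \<eta> 0)"
    and "x \<in> S \<Longrightarrow> 2 * gamma21 b q (\<lambda>x. G2 K \<eta> x - \<eta> 0) x = G1 K (D \<eta>) x + D \<eta> 0 * (f x - 2)"
proof -
  have D: "(\<eta> has_vector_derivative D \<eta> y) (at y within S)" if "y \<in> S" for y
    using C_on_Suc_has_vector_derivative[of 0 S \<eta> y] assms that by simp
  have cont: "continuous_on S \<eta>" and cont': "continuous_on S (D \<eta>)"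
    using assms C_on_imp_continuous_on[OF assms] C_on_Suc[of 0 S \<eta>] by (auto simp: C_on_0)
  let ?g = "G_minus K \<eta>"
  define d where "d y = G_plus K (D \<eta>) y - \<eta> 0 * segint q y + segint (\<lambda>s. q s * ?g s) y" for y
  have g_cont: "continuous_on S ?g"
    by (intro G_minus_cont continuous_intros cont)
  have deriv: "((\<lambda>x. G2 K \<eta> x - \<eta> 0) has_vector_derivative d y) (at y within S)" if "y \<in> S" for y
    using has_vector_derivative_diff[OF G_minus_deriv[OF D cont' that] has_vector_derivative_const[of "\<eta> 0"]]
    unfolding G2_def d_def by simp
  have d_cont: "continuous_on S d"
    unfolding d_def
    by (intro continuous_intros G_plus_cont cont' continuous_on_segint q_cont g_cont)
  show "C_on 1 S (\<lambda>x. G2 K \<eta> x - \<eta> 0)"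
    using C_on_SucI[OF b_pos deriv, of 0] d_cont by (simp add: C_on_0)
  assume x: "x \<in> S"
  have "segint (\<lambda>s. q s * (G2 K \<eta> s - \<eta> 0)) x = segint (\<lambda>s. q s * ?g s + - \<eta> 0 * q s) x"
    unfolding G2_def by (simp add: algebra_simps)
  also have "\<dots> = segint (\<lambda>s. q s * ?g s) x + - \<eta> 0 * segint q x"
    by (subst segint_add[OF _ _ x], (intro continuous_intros q_cont g_cont)+) (simp only: segint_mult_left)
  finally have I: "segint (\<lambda>s. q s * (G2 K \<eta> s - \<eta> 0)) x = \<dots>" .
  have d0: "d 0 = D \<eta> 0"
    unfolding d_def G_plus_0 by simp
  have "continuous_on S (\<lambda>x. G2 K \<eta> x - \<eta> 0)"
    unfolding G2_def by (intro continuous_intros g_cont)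
  then have "2 * gamma21 b q (\<lambda>x. G2 K \<eta> x - \<eta> 0) x = d x - d 0 - segint (\<lambda>s. q s * (G2 K \<eta> s - \<eta> 0)) x"
    by (subst gamma21_eq[OF b_pos q_cont _ x deriv]) simp_all
  also have "\<dots> = G1 K (D \<eta>) x + D \<eta> 0 * (f x - 2)"
    unfolding I d0 unfolding d_def G1_eq[OF cont' x] by (simp add: algebra_simps)
  finally show "2 * gamma21 b q (\<lambda>x. G2 K \<eta> x - \<eta> 0) x = G1 K (D \<eta>) x + D \<eta> 0 * (f x - 2)" .
qed

text \<open>Integrating \<open>f'' = q f\<close> says precisely \<open>T f = 0\<close>; this is why the term \<open>u\<^bsup>(n)\<^esup> (0) f\<close> never
  survives a further application of \<open>T\<close>.\<close>

lemma f_pow: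
  shows "gamma21_exists b q n f" and "x \<in> S \<Longrightarrow> T (Suc n) f x = 0"
proof -
  have f'_cont: "continuous_on S f'"
    using f_ode by (rule continuous_on_vector_derivative)
  have C1: "C_on 1 S f"
    using C_on_SucI[OF b_pos f_deriv, of 0] f'_cont by (simp add: C_on_0)
  have "\<forall>y\<in>S. 2 * gamma21 b q f y = 0"
  proof
    fix y assume y: "y \<in> S"
    have "continuous_on S (\<lambda>s. q s * f s)"
      by (intro continuous_intros q_cont f_cont)
    then have "f' y = f' 0 + segint (\<lambda>s. q s * f s) y"
      using f_ode y by (intro segint_derivative)
    then show "2 * gamma21 b q f y = 0"
      using gamma21_eq[OF b_pos q_cont f_cont y f_deriv] by simp
  qed
  note * = two_gamma21_pow_Suc[where g' = "\<lambda>_. 0", OF b_pos q_cont C1 this two_gamma21_pow_zero(1)[OF b_pos refl]]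
  from *(1)[of n] show "gamma21_exists b q n f" by simp
  show "T (Suc n) f x = 0" if "x \<in> S"
    using *(2)[OF that, of n] two_gamma21_pow_zero(2)[OF b_pos refl that] by simp
qed

text \<open>The residues of the two chains. For even \<open>n\<close> the upper limit of \<open>G2_sum\<close>, and for odd \<open>n\<close> that of
  \<open>G1_sum\<close>, may be lowered to \<open>n - 1\<close> by parity.\<close>

definition G1_sum :: "nat \<Rightarrow> (real \<Rightarrow> complex) \<Rightarrow> real \<Rightarrow> complex" where
  "G1_sum n u x = (\<Sum>j | j \<in> {2..n} \<and> even j. nderiv S j u 0 * T (n - j) (\<lambda>_. 1) x)"

definition G2_sum :: "nat \<Rightarrow> (real \<Rightarrow> complex) \<Rightarrow> real \<Rightarrow> complex" where
  "G2_sum n u x = (\<Sum>j | j \<in> {1..n} \<and> odd j. nderiv S j u 0 * T (n - j) (\<lambda>_. 1) x)"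

lemma G1_sum_Suc: "G1_sum (Suc n) u x = G2_sum n (D u) x"
proof -
  have "j \<in> Suc ` {j. j \<in> {1..n} \<and> odd j}" if "2 \<le> j" "j \<le> Suc n" "even j" for j
    using that by (intro image_eqI[of _ _ "j - 1"]) auto
  then have "{j. j \<in> {2..Suc n} \<and> even j} = Suc ` {j. j \<in> {1..n} \<and> odd j}"
    by auto
  then show ?thesis
    unfolding G1_sum_def G2_sum_def
    by (simp only: sum.reindex[OF inj_on_subset[OF inj_Suc subset_UNIV]] o_def diff_Suc_Suc nderiv_Suc)
qed

lemma G2_sum_Suc: "G2_sum (Suc n) u x = G1_sum n (D u) x + D u 0 * T n (\<lambda>_. 1) x"
proof -
  have "{j. j \<in> {1..Suc n} \<and> odd j} = insert 1 {j. j \<in> {3..Suc n} \<and> odd j}"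
    unfolding set_eq_iff mem_Collect_eq insert_iff atLeastAtMost_iff by presburger
  then have "G2_sum (Suc n) u x = D u 0 * T n (\<lambda>_. 1) x
      + (\<Sum>j | j \<in> {3..Suc n} \<and> odd j. nderiv S j u 0 * T (Suc n - j) (\<lambda>_. 1) x)"
    unfolding G2_sum_def by simp
  also have "(\<Sum>j | j \<in> {3..Suc n} \<and> odd j. nderiv S j u 0 * T (Suc n - j) (\<lambda>_. 1) x) = G1_sum n (D u) x"
  proof -
    have "j \<in> Suc ` {j. j \<in> {2..n} \<and> even j}" if "3 \<le> j" "j \<le> Suc n" "odd j" for j
      using that by (intro image_eqI[of _ _ "j - 1"]) auto
    then have "{j. j \<in> {3..Suc n} \<and> odd j} = Suc ` {j. j \<in> {2..n} \<and> even j}"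
      by auto
    then show ?thesis
      unfolding G1_sum_def
      by (simp only: sum.reindex[OF inj_on_subset[OF inj_Suc subset_UNIV]] o_def diff_Suc_Suc nderiv_Suc)
  qed
  finally show ?thesis by simp
qed

text \<open>The \<open>G\<^sub>1\<close> formula fails for \<open>n = 0\<close>, where the term \<open>u (0) f\<close> is absent; hence the guard
  \<open>1 \<le> n\<close>, and the first application of \<open>T\<close> is a separate case of the induction step.\<close>

lemma powers_of_G:
  assumes q: "C_on p S q"
  shows "C_on n S u \<Longrightarrow> n \<le> p + 4 \<Longrightarrow> gamma21_exists b q n (G1 K u) \<and>
      (1 \<le> n \<longrightarrow> (\<forall>x\<in>S. T n (G1 K u) x =
         (if even n then G1 K (nderiv S n u) x + f x * nderiv S n u 0
          else G2 K (nderiv S n u) x - nderiv S n u 0) - 2 * G1_sum n u x))"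
    and "C_on n S u \<Longrightarrow> n \<le> p + 3 \<Longrightarrow> gamma21_exists b q n (\<lambda>x. G2 K u x - u 0) \<and>
      (1 \<le> n \<longrightarrow> (\<forall>x\<in>S. T n (\<lambda>x. G2 K u x - u 0) x =
         (if odd n then G1 K (nderiv S n u) x + f x * nderiv S n u 0
          else G2 K (nderiv S n u) x - nderiv S n u 0) - 2 * G2_sum n u x))"
proof (induction n arbitrary: u)
  case (Suc n)
  {
    case 1
    have C1: "C_on 1 S u" and Du: "C_on n S (D u)"
      using 1 C_on_le[of "Suc n" S u 1] by (auto simp: C_on_Suc[of n])
    have IH: "gamma21_exists b q n (\<lambda>x. G2 K (D u) x - D u 0)"
      "1 \<le> n \<Longrightarrow> x \<in> S \<Longrightarrow> T n (\<lambda>x. G2 K (D u) x - D u 0) x =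
         (if odd n then G1 K (nderiv S n (D u)) x + f x * nderiv S n (D u) 0
          else G2 K (nderiv S n (D u)) x - nderiv S n (D u) 0) - 2 * G2_sum n (D u) x" for x
      using Suc.IH(2)[OF Du] 1 by auto
    have "\<forall>x\<in>S. 2 * gamma21 b q (G1 K u) x = G2 K (D u) x - D u 0"
      using G1_step(2)[OF C1] by blast
    note step = two_gamma21_pow_Suc[OF b_pos q_cont G1_step(1)[OF C1] this IH(1)]
    have "T (Suc n) (G1 K u) x =
         (if even (Suc n) then G1 K (nderiv S (Suc n) u) x + f x * nderiv S (Suc n) u 0
          else G2 K (nderiv S (Suc n) u) x - nderiv S (Suc n) u 0) - 2 * G1_sum (Suc n) u x"
      if x: "x \<in> S" for x
    proof (cases n)
      case 0
      then show ?thesis using step(2)[OF x] by (simp add: G1_sum_Suc G2_sum_def)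
    next
      case (Suc m)
      then show ?thesis
        unfolding step(2)[OF x] nderiv_Suc[of _ n] G1_sum_Suc using IH(2)[OF _ x] by simp
    qed
    with step(1) show ?case by blast
  next
    case 2
    have C1: "C_on 1 S u" and Du: "C_on n S (D u)"
      using 2 C_on_le[of "Suc n" S u 1] by (auto simp: C_on_Suc[of n])
    have IH: "gamma21_exists b q n (G1 K (D u))"
      "1 \<le> n \<Longrightarrow> x \<in> S \<Longrightarrow> T n (G1 K (D u)) x =
         (if even n then G1 K (nderiv S n (D u)) x + f x * nderiv S n (D u) 0
          else G2 K (nderiv S n (D u)) x - nderiv S n (D u) 0) - 2 * G1_sum n (D u) x" for x
      using Suc.IH(1)[OF Du] 2 by auto
    have one: "gamma21_exists b q n (\<lambda>_. 1)"
      using gamma21_exists_one[OF b_pos q, of n] 2 by simp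
    note add1 = two_gamma21_pow_add[where c = "D u 0", OF b_pos q_cont IH(1) f_pow(1)]
    note add2 = two_gamma21_pow_add[where c = "- 2 * D u 0", OF b_pos q_cont add1(1) one]
    have gamma: "\<forall>x\<in>S. 2 * gamma21 b q (\<lambda>x. G2 K u x - u 0) x =
        G1 K (D u) x + D u 0 * f x + - 2 * D u 0 * 1"
      using G2_step(2)[OF C1] by (simp add: algebra_simps)
    note step = two_gamma21_pow_Suc[OF b_pos q_cont G2_step(1)[OF C1] gamma add2(1)]
    have eq: "T (Suc n) (\<lambda>x. G2 K u x - u 0) x =
       T n (G1 K (D u)) x + D u 0 * T n f x - 2 * D u 0 * T n (\<lambda>_. 1) x" if x: "x \<in> S" for x
      unfolding step(2)[OF x] add2(2)[OF x] add1(2)[OF x] by simp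
    have "T (Suc n) (\<lambda>x. G2 K u x - u 0) x =
         (if odd (Suc n) then G1 K (nderiv S (Suc n) u) x + f x * nderiv S (Suc n) u 0
          else G2 K (nderiv S (Suc n) u) x - nderiv S (Suc n) u 0) - 2 * G2_sum (Suc n) u x"
      if x: "x \<in> S" for x
    proof (cases n)
      case 0
      then show ?thesis using eq[OF x] by (simp add: G2_sum_Suc G1_sum_def algebra_simps)
    next
      case (Suc m)
      then have "T n f x = 0" using f_pow(2)[OF x] by simp
      with Suc show ?thesis
        unfolding eq[OF x] nderiv_Suc[of _ n] G2_sum_Suc using IH(2)[OF _ x] by (simp add: algebra_simps)
    qed
    with step(1) show ?case by blast
  }
qed simp_all

end

theorem corollary6p5:
  fixes b :: real and p m :: nat and h :: complex
    and q f f' u :: "real \<Rightarrow> complex" and H K :: "real \<Rightarrow> real \<Rightarrow> complex"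
  defines "h \<equiv> f' 0"
    and "K \<equiv> kernel_of H"
  assumes b_pos: "0 < b"
    and q_reg: "C_on p {- b..b} q"
    and f_deriv: "\<And>x. x \<in> {- b..b} \<Longrightarrow>
          (f has_vector_derivative f' x) (at x within {- b..b})"
    and f_ode: "\<And>x. x \<in> {- b..b} \<Longrightarrow>
          (f' has_vector_derivative q x * f x) (at x within {- b..b})"
    and f_nonzero: "\<And>x. x \<in> {- b..b} \<Longrightarrow> f x \<noteq> 0"
    and f_zero: "f 0 = 1"
    and H_sol: "goursat_solution b q h H"
    and u_reg: "C_on m {- b..b} u"
  shows
    "(\<forall>j \<le> min m (p + 4). gamma21_exists b q j (G1 K u)) \<and>
     (\<forall>j \<le> min m (p + 3). gamma21_exists b q j (\<lambda>x. G2 K u x - u 0)) \<and>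
     (\<forall>i < min m (p + 3). gamma21_exists b q i (\<lambda>_. 1)) \<and>
     (\<forall>n. 1 \<le> n \<longrightarrow> n \<le> min m (p + 4) \<longrightarrow> even n \<longrightarrow> (\<forall>x\<in>{- b..b}.
        two_gamma21_pow b q n (G1 K u) x =
          G1 K (nderiv {- b..b} n u) x + f x * nderiv {- b..b} n u 0
          - 2 * (\<Sum>j | j \<in> {2..n} \<and> even j.
                   nderiv {- b..b} j u 0 * two_gamma21_pow b q (n - j) (\<lambda>_. 1) x))) \<and>
     (\<forall>n. 1 \<le> n \<longrightarrow> n \<le> min m (p + 3) \<longrightarrow> even n \<longrightarrow> (\<forall>x\<in>{- b..b}.
        two_gamma21_pow b q n (\<lambda>x. G2 K u x - u 0) x =
          G2 K (nderiv {- b..b} n u) x - nderiv {- b..b} n u 0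
          - 2 * (\<Sum>j | j \<in> {1..n - 1} \<and> odd j.
                   nderiv {- b..b} j u 0 * two_gamma21_pow b q (n - j) (\<lambda>_. 1) x))) \<and>
     (\<forall>n. 1 \<le> n \<longrightarrow> n \<le> min m (p + 4) \<longrightarrow> odd n \<longrightarrow> (\<forall>x\<in>{- b..b}.
        two_gamma21_pow b q n (G1 K u) x =
          G2 K (nderiv {- b..b} n u) x - nderiv {- b..b} n u 0
          - 2 * (\<Sum>j | j \<in> {2..n - 1} \<and> even j.
                   nderiv {- b..b} j u 0 * two_gamma21_pow b q (n - j) (\<lambda>_. 1) x))) \<and>
     (\<forall>n. 1 \<le> n \<longrightarrow> n \<le> min m (p + 3) \<longrightarrow> odd n \<longrightarrow> (\<forall>x\<in>{- b..b}.
        two_gamma21_pow b q n (\<lambda>x. G2 K u x - u 0) x =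
          G1 K (nderiv {- b..b} n u) x + f x * nderiv {- b..b} n u 0
          - 2 * (\<Sum>j | j \<in> {1..n} \<and> odd j.
                   nderiv {- b..b} j u 0 * two_gamma21_pow b q (n - j) (\<lambda>_. 1) x)))"
proof -
  interpret transmutation b q f f' H
    using assms C_on_imp_continuous_on by unfold_locales auto
  have u: "C_on n {- b..b} u" if "n \<le> m" for n
    using C_on_le[OF u_reg that] .
  note G1 = powers_of_G(1)[OF q_reg u, folded K_def, unfolded G1_sum_def]
    and G2 = powers_of_G(2)[OF q_reg u, folded K_def, unfolded G2_sum_def]
  have even_range: "{j. j \<in> {1..n - 1} \<and> odd j} = {j. j \<in> {1..n} \<and> odd j}" if "even n" for n :: nat
    using that by (auto simp: le_less)
  have odd_range: "{j. j \<in> {2..n - 1} \<and> even j} = {j. j \<in> {2..n} \<and> even j}" if "odd n" for n :: nat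
    using that by (auto simp: le_less)
  show ?thesis
    using G1 G2 gamma21_exists_one[OF b_pos q_reg] even_range odd_range by simp
qed

end
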